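(* Let $r$ be a positive integer, and consider the perturbed $r$-chain of integrators $$\dot z_i=z_{i+1}\ (1\le i\le r-1),\qquad \dot z_r=\varphi(t)+\gamma(t)u,$$ where $\varphi,\gamma$ are measurable and satisfy $|\varphi(t)|\le\bar\varphi$ and $0<\gamma_m\le\gamma(t)\le\gamma_M$ for a.e. $t\ge 0$, for some positive constants $\bar\varphi,\gamma_m,\gamma_M$. Let $u_0,V,g,k,\eta,\hat\varphi$ be as in the context. Then the controller $$u=g(|u_0(z)|)\,u_0(z)+k\,\mathrm{sgn}(u_0(z))\,\hat\varphi$$ satisfies, along trajectories of the corresponding closed-loop system, the following asymptotic upper bound, which is uniform with respect to trajectories (the right-hand side does not depend on the trajectory): $$\limsup_{t\to\infty}|u|\le M(u_0)+k\max(1,\bar\Phi),$$ where $$\bar\Phi=\frac1{k\gamma_m}(\bar\varphi-h_m),\qquad h_m=\min\Big(0,\min_{x\ge0}x(\gamma_m g(x)-1)\Big),$$ and $M(u_0)=g(l_r)\,l_r$ with $l_r=\sup_{\mathbb{R}^r}|u_0|$ if $u_0$ is homogeneous of degree zero, while $M(u_0)=0$ if $u_0$ is homogeneous of positive degree.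
   Context: Notation. $\mathrm{sgn}$ is the multivalued function $\mathrm{sgn}(x)=x/|x|$ for $x\ne0$, $\mathrm{sgn}(0)=[-1,1]$. $J_r$ is the $r\times r$ matrix whose $(i,j)$ entry is $1$ if $i=j-1$ and $0$ otherwise, and $e_r=(0,\dots,0,1)^T\in\mathbb{R}^r$. $\mathbb{R}_+^*=(0,\infty)$. Solutions of (discontinuous) closed-loop systems are understood in Filippov's sense. Weights and homogeneity. Fix $\kappa<0$ and $p>0$ with $p+(r+1)\kappa\in[0,1)$, and set $p_i=p+(i-1)\kappa$ for $1\le i\le r+2$. For $\lambda>0$ let $\delta_\lambda(z)=(\lambda^{p_1}z_1,\dots,\lambda^{p_r}z_r)$. A function $f:\mathbb{R}^r\to\mathbb{R}^m$ is homogeneous of degree $q$ with respect to $(\delta_\lambda)_{\lambda>0}$ if $f(\delta_\lambda(z))=\lambda^q f(z)$ for all $\lambda>0$, $z\in\mathbb{R}^r$; a vector field (or differential inclusion) $F$ on $\mathbb{R}^r$ is homogeneous of degree $q$ if $F(\delta_\lambda(z))=\lambda^q\delta_\lambda(F(z))$. Standing Assumption on $(u_0,V)$. The feedback law $u_0:\mathbb{R}^r\to\mathbb{R}$ is homogeneous with respect to $(\delta_\lambda)_{\lambda>0}$, the closed-loop system $\dot z=J_rz+u_0(z)e_r$ is finite-time globally asymptotically stable with respect to the origin, and: (i) $z\mapsto J_rz+u_0(z)e_r$ is homogeneous of degree $\kappa$ with respect to $(\delta_\lambda)$; $V:\mathbb{R}^r\to\mathbb{R}_+$ is continuous, positive definite,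 $C^1$ except at the origin, homogeneous of positive degree with respect to $(\delta_\lambda)$, and there exist $c>0$ and $\alpha\in(0,1)$ such that, along non-trivial trajectories of $\dot z=J_rz+u_0(z)e_r$, $\dot V\le -cV^\alpha$; (ii) $z\mapsto u_0(z)\,\frac{\partial V}{\partial z_r}(z)$ is non-positive over $\mathbb{R}^r$, and for every non-zero $z$ with $u_0(z)=0$ one has $\frac{\partial V}{\partial z_r}(z)=0$. (Consequently $z\mapsto\mathrm{sgn}(u_0(z))\frac{\partial V}{\partial z_r}(z)$ is well defined and non-positive on $\mathbb{R}^r\setminus\{0\}$.) Controller data. $g:\mathbb{R}_+\to\mathbb{R}_+^*$ is an arbitrary increasing $C^1$ function with $g(x)\to\infty$ as $x\to\infty$; $k>0$ is a constant. $\eta:\mathbb{R}_+\to\mathbb{R}_+^*$ is a non-increasing $C^1$ function with $\eta(0)=\varepsilon>0$, $-\dot\eta\le M\eta$ and $\eta(t)\to0$ as $t\to\infty$ (so that the sets $D(t)=\{z\in\mathbb{R}^r: V(z)\le\eta(t)\}$ decrease to the origin), where $\varepsilon>0$ and $M\ge0$ are such that $M\varepsilon^{1-\alpha}<c$. For $\xi>0$, $F_\xi(x)=\frac{\xi}{\xi-x}$ for $x\in[0,\xi)$. Time-varying gain $\hat\varphi$. Along a trajectory $z(\cdot)$ of the closed-loop system starting at $z_0$: if $V(z_0)\le\varepsilon/2$, put $\bar t(V(z_0))=0$; if $V(z_0)>\varepsilon/2$, let $\bar t(V(z_0))>0$ be the first time $t$ at which $V(z(t))=\eta(t)/2$, with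 $\bar t(V(z_0))=\infty$ if there is no such time. (This time may depend on the trajectory, not only on $V(z_0)$.) As long as $z(\cdot)$ is defined, the gain at time $t$ is $$\hat\varphi=t\ \text{ if }0\le t<\bar t(V(z_0)),\qquad \hat\varphi=F_{\eta(t)}(V(z(t)))\ \text{ if } t\ge\bar t(V(z_0)).$$ *)

theory Defs
  imports "HOL-Analysis.Analysis"
begin

section \<open>Chains of integrators and weighted dilations\<close>

text \<open>
  Vectors of \<open>\<real>\<^sup>r\<close> are elements of type \<open>real^'n\<close>, with \<open>r = CARD('n)\<close>. The linear order of the
  index type gives the coordinates their numbering \<open>1, \<dots>, r\<close>: the coordinate \<open>z\<^sub>k\<close> is \<open>z $ i\<close> for
  the index \<open>i\<close> with \<open>pos i = k\<close>.
\<close>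

definition pos :: "'n::{finite,linorder} \<Rightarrow> nat" where
  "pos i = card {j. j \<le> i}"

definition Jr :: "real^'n::{finite,linorder}^'n::_" where
  "Jr = (\<chi> i j. if pos j = pos i + 1 then 1 else 0)"

definition er :: "real^'n::{finite,linorder}" where
  "er = (\<chi> i. if pos i = CARD('n) then 1 else 0)"

definition dil :: "real \<Rightarrow> real \<Rightarrow> real \<Rightarrow> real^'n::{finite,linorder} \<Rightarrow> real^'n::_" where
  "dil p \<kappa> l z = (\<chi> i. l powr (p + (real (pos i) - 1) * \<kappa>) * z $ i)"

definition homogeneous_fun ::
  "real \<Rightarrow> real \<Rightarrow> real \<Rightarrow> (real^'n::{finite,linorder} \<Rightarrow> 'b::real_vector) \<Rightarrow> bool" where
  "homogeneous_fun p \<kappa> q f \<longleftrightarrow> (\<forall>l>0. \<forall>z. f (dil p \<kappa> l z) = l powr q *\<^sub>R f z)"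

definition homogeneous_field ::
  "real \<Rightarrow> real \<Rightarrow> real \<Rightarrow> (real^'n::{finite,linorder} \<Rightarrow> real^'n::_) \<Rightarrow> bool" where
  "homogeneous_field p \<kappa> q F \<longleftrightarrow>
     (\<forall>l>0. \<forall>z. F (dil p \<kappa> l z) = l powr q *\<^sub>R dil p \<kappa> l (F z))"

section \<open>Filippov solutions\<close>

text \<open>
  Filippov regularisation of a possibly multivalued map: for a single-valued \<open>f\<close> one takes
  \<open>F y = {f y}\<close>.
\<close>

definition filippov ::
  "('a::euclidean_space \<Rightarrow> 'b::euclidean_space set) \<Rightarrow> 'a \<Rightarrow> 'b set" where
  "filippov F x =
     (\<Inter>d\<in>{0<..}. \<Inter>N\<in>{N. negligible N}. closure (convex hull (\<Union>y\<in>ball x d - N. F y)))"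

text \<open>
  Solutions are absolutely continuous, that is, indefinite integrals of their a.e. derivative \<open>v\<close>,
  which is Lebesgue integrable on compact subintervals. The time domain \<open>I\<close> is an interval
  with left end point \<open>0\<close>.
\<close>

definition filippov_solution ::
  "(real \<Rightarrow> 'a::euclidean_space \<Rightarrow> 'a set) \<Rightarrow> real set \<Rightarrow> (real \<Rightarrow> 'a) \<Rightarrow> bool" where
  "filippov_solution F I x \<longleftrightarrow>
     (\<exists>v. (\<forall>t\<in>I. v absolutely_integrable_on {0..t} \<and> x t = x 0 + integral {0..t} v) \<and>
          (AE t in lebesgue_on I. v t \<in> filippov (F t) (x t)))"

text \<open>The class of right-hand sides for which Filippov solutions are considered.\<close>

definition locally_ess_bounded :: "('a::euclidean_space \<Rightarrow> 'b::real_normed_vector) \<Rightarrow> bool" where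
  "locally_ess_bounded f \<longleftrightarrow> (\<forall>R. \<exists>B. AE x in lebesgue. norm x \<le> R \<longrightarrow> norm (f x) \<le> B)"

text \<open>
  Finite-time global asymptotic stability of the origin for \<open>x' = f x\<close>: solutions exist and can
  be continued to \<open>[0,\<infinity>)\<close>, the origin is Lyapunov stable, and every solution starting at \<open>x0\<close> is at
  the origin from some settling time \<open>T x0\<close> on.
\<close>

definition finite_time_GAS :: "('a::euclidean_space \<Rightarrow> 'a) \<Rightarrow> bool" where
  "finite_time_GAS f \<longleftrightarrow>
     (let sol = filippov_solution (\<lambda>t y. {f y}) in
       (\<forall>x0. \<exists>x. sol {0..} x \<and> x 0 = x0) \<and>
       (\<forall>\<tau>>0. \<forall>x. sol {0..<\<tau>} x \<longrightarrow> (\<exists>y. sol {0..} y \<and> (\<forall>t\<in>{0..<\<tau>}. y t = x t))) \<and>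
       (\<forall>e>0. \<exists>d>0. \<forall>x. sol {0..} x \<and> norm (x 0) < d \<longrightarrow> (\<forall>t\<ge>0. norm (x t) < e)) \<and>
       (\<exists>T. \<forall>x. sol {0..} x \<longrightarrow> (\<forall>t\<ge>T (x 0). 0 \<le> t \<longrightarrow> x t = 0)))"

section \<open>Lyapunov functions\<close>

definition C1_on :: "'a::real_normed_vector set \<Rightarrow> ('a \<Rightarrow> 'b::real_normed_vector) \<Rightarrow> bool" where
  "C1_on S f \<longleftrightarrow>
     (\<exists>f' :: 'a \<Rightarrow> 'a \<Rightarrow>\<^sub>L 'b.
        (\<forall>x\<in>S. (f has_derivative blinfun_apply (f' x)) (at x within S)) \<and> continuous_on S f')"

text \<open>
  The values at \<open>z\<close> of the derivative of \<open>V\<close> along the Filippov trajectories of \<open>x' = f x\<close>; there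
  may be several, one for each admissible velocity.
\<close>

definition orbital_derivatives ::
  "('a::euclidean_space \<Rightarrow> 'a) \<Rightarrow> ('a \<Rightarrow> real) \<Rightarrow> 'a \<Rightarrow> real set" where
  "orbital_derivatives f V z = frechet_derivative V (at z) ` filippov (\<lambda>y. {f y}) z"

text \<open>The partial derivative with respect to the last coordinate.\<close>

definition dV_last :: "(real^'n::{finite,linorder} \<Rightarrow> real) \<Rightarrow> real^'n::_ \<Rightarrow> real" where
  "dV_last V z = frechet_derivative V (at z) er"

section \<open>The controller\<close>

definition msgn :: "real \<Rightarrow> real set" where
  "msgn x = (if x = 0 then {-1..1} else {x / \<bar>x\<bar>})"

definition nominal_field :: "(real^'n::{finite,linorder} \<Rightarrow> real) \<Rightarrow> real^'n::_ \<Rightarrow> real^'n::_" where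
  "nominal_field u0 z = Jr *v z + u0 z *\<^sub>R er"

definition barrier :: "real \<Rightarrow> real \<Rightarrow> real" where
  "barrier \<xi> x = \<xi> / (\<xi> - x)"

text \<open>
  The infimum of the empty set is \<open>\<infinity>\<close>; for a continuous trajectory the infimum of a non-empty set of
  crossing times is attained.
\<close>

definition switch_time ::
  "(real \<Rightarrow> real) \<Rightarrow> ('a \<Rightarrow> real) \<Rightarrow> (real \<Rightarrow> 'a) \<Rightarrow> ereal" where
  "switch_time \<eta> V z =
     (if V (z 0) \<le> \<eta> 0 / 2 then 0 else Inf (ereal ` {t. 0 < t \<and> V (z t) = \<eta> t / 2}))"

text \<open>
  Since the switching time is a functional of the whole trajectory \<open>z\<close>, the feedback depends on \<open>z\<close>
  besides the current time \<open>t\<close> and the current state \<open>y\<close>.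
\<close>

definition gain ::
  "(real \<Rightarrow> real) \<Rightarrow> ('a \<Rightarrow> real) \<Rightarrow> (real \<Rightarrow> 'a) \<Rightarrow> real \<Rightarrow> 'a \<Rightarrow> real" where
  "gain \<eta> V z t y = (if ereal t < switch_time \<eta> V z then t else barrier (\<eta> t) (V y))"

definition feedback ::
  "('a \<Rightarrow> real) \<Rightarrow> ('a \<Rightarrow> real) \<Rightarrow> (real \<Rightarrow> real) \<Rightarrow> real \<Rightarrow> (real \<Rightarrow> real)
    \<Rightarrow> (real \<Rightarrow> 'a) \<Rightarrow> real \<Rightarrow> 'a \<Rightarrow> real set" where
  "feedback u0 V g k \<eta> z t y =
     {g \<bar>u0 y\<bar> * u0 y + k * s * gain \<eta> V z t y | s. s \<in> msgn (u0 y)}"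

text \<open>
  The last conjunct says that, from the switching time on, the trajectory stays in the domain
  \<open>[0, \<eta> t)\<close> on which the barrier gain is defined. The state enters \<open>gain\<close> continuously there, so
  the values that \<open>barrier\<close> takes outside that domain do not influence the regularisation.
\<close>

definition closed_loop_trajectory ::
  "(real^'n::{finite,linorder} \<Rightarrow> real) \<Rightarrow> (real^'n::_ \<Rightarrow> real) \<Rightarrow> (real \<Rightarrow> real) \<Rightarrow> real \<Rightarrow>
   (real \<Rightarrow> real) \<Rightarrow> (real \<Rightarrow> real) \<Rightarrow> (real \<Rightarrow> real) \<Rightarrow> (real \<Rightarrow> real^'n::_) \<Rightarrow> bool" where
  "closed_loop_trajectory u0 V g k \<eta> \<phi> \<gamma> z \<longleftrightarrow>
     filippov_solution
       (\<lambda>t y. (\<lambda>u. Jr *v y + (\<phi> t + \<gamma> t * u) *\<^sub>R er) ` feedback u0 V g k \<eta> z t y) {0..} z \<and>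
     (\<forall>t\<ge>0. switch_time \<eta> V z \<le> ereal t \<longrightarrow> V (z t) < \<eta> t)"

text \<open>
  A control signal along \<open>z\<close>: any choice among the values of the regularised feedback.
\<close>

definition control_along ::
  "(real^'n::{finite,linorder} \<Rightarrow> real) \<Rightarrow> (real^'n::_ \<Rightarrow> real) \<Rightarrow> (real \<Rightarrow> real) \<Rightarrow> real \<Rightarrow>
   (real \<Rightarrow> real) \<Rightarrow> (real \<Rightarrow> real^'n::_) \<Rightarrow> (real \<Rightarrow> real) \<Rightarrow> bool" where
  "control_along u0 V g k \<eta> z u \<longleftrightarrow>
     (\<forall>t\<ge>0. u t \<in> filippov (feedback u0 V g k \<eta> z t) (z t))"

section \<open>The constants of the asymptotic bound\<close>

definition hm :: "real \<Rightarrow> (real \<Rightarrow> real) \<Rightarrow> real" where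
  "hm \<gamma>m g = min 0 (INF x\<in>{0..}. x * (\<gamma>m * g x - 1))"

definition Phi_bar :: "real \<Rightarrow> real \<Rightarrow> (real \<Rightarrow> real) \<Rightarrow> real \<Rightarrow> real" where
  "Phi_bar k \<gamma>m g \<phi>b = 1 / (k * \<gamma>m) * (\<phi>b - hm \<gamma>m g)"

text \<open>The two cases, degree zero and positive degree, agree on the zero function.\<close>

definition M_u0 ::
  "real \<Rightarrow> real \<Rightarrow> (real \<Rightarrow> real) \<Rightarrow> (real^'n::{finite,linorder} \<Rightarrow> real) \<Rightarrow> real" where
  "M_u0 p \<kappa> g u0 =
     (if homogeneous_fun p \<kappa> 0 u0
      then g (SUP z. \<bar>u0 z\<bar>) * (SUP z. \<bar>u0 z\<bar>) else 0)"

end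

theory Submission
  imports Defs
begin

text \<open>
  The field homogeneity forces the degree of \<open>u\<^sub>0\<close> to be \<open>q = p + r\<kappa>\<close>, and \<open>p + (r+1)\<kappa> \<ge> 0\<close> with
  \<open>\<kappa> < 0\<close> gives \<open>q > 0\<close>. Hence \<open>M(u\<^sub>0) = 0\<close>, and \<open>u\<^sub>0\<close> is essentially small near the origin
  (\<open>homogeneous_essentially_small\<close>). Once the trajectory is close to the origin, the control is therefore
  governed by the term \<open>k sgn(u\<^sub>0) \<Gamma>\<close> with \<open>\<Gamma>\<close> the time-varying gain, and everything reduces to showing
  that this gain is asymptotically at most \<open>max 1 \<Phi>\<close>, where \<open>\<Phi>\<close> is the constant \<open>Phi_bar\<close>.

  The constant \<open>\<Phi>\<close> is the gain that dominates the perturbation: as soon as the gain is at least \<open>\<Phi>\<close>,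
  every Filippov velocity of the perturbed closed loop makes \<open>V\<close> decrease as fast as in the nominal
  system, \<open>V' \<le> - c V\<^sup>\<alpha>\<close> (\<open>velocity_decreases\<close>). Two consequences follow.

  First, in the initial phase the gain is \<open>t\<close>, hence eventually exceeds \<open>\<Phi>\<close>; then \<open>V\<^bsup>1-\<alpha>\<^esup>\<close> decreases at
  least linearly, which is impossible forever. So the switching time is finite.

  Second, after switching the gain is \<open>1 / (1 - V/\<eta>)\<close>. As long as it exceeds \<open>max 1 \<Phi>\<close> by a fixed amount,
  \<open>ln V\<close> decreases at rate at least \<open>c \<epsilon>\<^bsup>\<alpha>-1\<^esup>\<close>, because \<open>V < \<eta> \<le> \<epsilon>\<close>, whereas \<open>ln \<eta>\<close> decreases at rate
  at most \<open>M < c \<epsilon>\<^bsup>\<alpha>-1\<^esup>\<close>. So the ratio \<open>V/\<eta>\<close> falls at a definite rate until the gain is below the given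
  level, and cannot rise above it again (\<open>eventually_below_ratio\<close>). Moreover \<open>V < \<eta> \<longlongrightarrow> 0\<close> drives the trajectory
  to the origin.

  Two technical points shape the lemmas. The nominal feedback is only measurable and locally essentially
  bounded, so velocities are tested against the linear form \<open>dV(z)\<close>: a bound that holds at almost all nearby
  points passes to the closed convex hull. And \<open>V\<close> composed with a trajectory is treated through increments
  over short intervals (\<open>integral_curve_decrease\<close>), so that velocities are only ever integrated.
\<close>

section \<open>Filippov regularisation\<close>

text \<open>
  A half-space is closed and convex, so an affine bound on the values at almost all points of one ball is
  inherited by the regularisation. All information about Filippov velocities and control values below is
  extracted in this form.
\<close>

lemma filippov_linear_le:
  fixes l :: "'b::euclidean_space \<Rightarrow> real"
  assumes l: "linear l" and "d > 0" and "negligible N"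
    and le: "\<And>y w. y \<in> ball x d - N \<Longrightarrow> w \<in> F y \<Longrightarrow> l w \<le> b"
    and v: "v \<in> filippov F x"
  shows "l v \<le> b"
proof -
  have halfspace: "{w. l w \<le> b} = l -` {..b}" by auto
  have "v \<in> closure (convex hull (\<Union>y\<in>ball x d - N. F y))"
    using v \<open>d > 0\<close> \<open>negligible N\<close> unfolding filippov_def by blast
  also have "\<dots> \<subseteq> {w. l w \<le> b}"
  proof (intro closure_minimal hull_minimal)
    show "(\<Union>y\<in>ball x d - N. F y) \<subseteq> {w. l w \<le> b}" using le by blast
    show "convex {w. l w \<le> b}"
      unfolding halfspace by (intro convex_linear_vimage l convex_real_interval)
    show "closed {w. l w \<le> b}"
      using l by (intro closed_Collect_le continuous_intros linear_continuous_on)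
        (simp add: linear_conv_bounded_linear)
  qed
  finally show ?thesis by simp
qed

text \<open>
  The number \<open>a\<close> is the essential limit inferior of \<open>f\<close> at \<open>x\<close>. The first property says that \<open>f\<close> is
  almost everywhere nearly above \<open>a\<close> close to \<open>x\<close>, the second that \<open>a\<close> is an essential cluster value, so
  that it belongs to the regularisation of \<open>f\<close> at \<open>x\<close>.
\<close>

lemma essential_infimum_at_point:
  fixes f :: "'a::euclidean_space \<Rightarrow> real"
  assumes "locally_ess_bounded f"
  obtains a where
    "\<And>e. e > 0 \<Longrightarrow> \<exists>d>0. negligible {y \<in> ball x d. f y < a - e}"
    "\<And>e d N. e > 0 \<Longrightarrow> d > 0 \<Longrightarrow> negligible N \<Longrightarrow> \<exists>y\<in>ball x d - N. \<bar>f y - a\<bar> \<le> e"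
proof -
  define A where "A = {b. \<exists>d>0. negligible {y \<in> ball x d. f y < b}}"
  have not_in: "\<not> negligible {y \<in> ball x d. f y < b}" if "b \<notin> A" "d > 0" for b d
    using that unfolding A_def by blast
  obtain B where "AE y in lebesgue. norm y \<le> norm x + 1 \<longrightarrow> norm (f y) \<le> B"
    using assms unfolding locally_ess_bounded_def by blast
  then obtain N0 where N0: "negligible N0"
    "\<And>y. y \<notin> N0 \<Longrightarrow> norm y \<le> norm x + 1 \<Longrightarrow> norm (f y) \<le> B"
    unfolding eventually_ae_filter_negligible by blast
  have bound: "\<bar>f y\<bar> \<le> B" if "y \<in> ball x 1 - N0" for y
  proof -
    have "norm (y - x) < 1" using that by (simp add: dist_norm norm_minus_commute)
    then have "norm y \<le> norm x + 1" using norm_triangle_sub[of y x] by linarith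
    then show ?thesis using N0(2) that by simp
  qed
  have nonneg: "\<not> negligible (ball x d - N)" if "d > 0" "negligible N" for d N
  proof
    assume "negligible (ball x d - N)"
    then have "negligible ((ball x d - N) \<union> N)" using that(2) by (rule negligible_Un)
    then have "negligible (ball x d)" by (rule negligible_subset) auto
    then show False using open_not_negligible[of "ball x d"] that by simp
  qed
  have "-B \<in> A"
  proof -
    have "{y \<in> ball x 1. f y < - B} \<subseteq> N0" using bound by force
    then have "negligible {y \<in> ball x 1. f y < - B}" using N0(1) negligible_subset by blast
    then show ?thesis unfolding A_def by (intro CollectI exI[of _ 1]) simp
  qed
  then have nonempty: "A \<noteq> {}" by blast
  have above: "b \<le> B" if bA: "b \<in> A" for b
  proof -
    obtain d where d: "d > 0" "negligible {y \<in> ball x d. f y < b}"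
      using bA unfolding A_def by blast
    have "\<not> negligible (ball x (min d 1) - ({y \<in> ball x d. f y < b} \<union> N0))"
      using d N0(1) by (intro nonneg negligible_Un) auto
    then obtain y where "y \<in> ball x (min d 1) - ({y \<in> ball x d. f y < b} \<union> N0)"
      by (metis equals0I negligible_empty)
    then show ?thesis using bound[of y] by auto
  qed
  have bdd: "bdd_above A" using above by (rule bdd_aboveI)
  show thesis
  proof (rule that[of "Sup A"])
    show below: "\<exists>d>0. negligible {y \<in> ball x d. f y < Sup A - e}" if "e > 0" for e
    proof -
      obtain b where b: "b \<in> A" "Sup A - e < b"
        using less_cSup_iff[OF nonempty bdd, of "Sup A - e"] \<open>e > 0\<close> by auto
      then obtain d where d: "d > 0" "negligible {y \<in> ball x d. f y < b}"
        unfolding A_def by blast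
      have "{y \<in> ball x d. f y < Sup A - e} \<subseteq> {y \<in> ball x d. f y < b}" using b(2) by auto
      then show ?thesis using d negligible_subset by blast
    qed
    show "\<exists>y\<in>ball x d - N. \<bar>f y - Sup A\<bar> \<le> e" if "e > 0" "d > 0" "negligible N" for e d N
    proof -
      obtain d' where d': "d' > 0" "negligible {y \<in> ball x d'. f y < Sup A - e}"
        using below[OF \<open>e > 0\<close>] by blast
      have "Sup A + e \<notin> A"
        using cSup_upper[OF _ bdd] \<open>e > 0\<close> by force
      then have "\<not> negligible {y \<in> ball x (min d d'). f y < Sup A + e}"
        using not_in[of "Sup A + e" "min d d'"] d'(1) \<open>d > 0\<close> by simp
      then have "\<not> {y \<in> ball x (min d d'). f y < Sup A + e} \<subseteq> N \<union> {y \<in> ball x d'. f y < Sup A - e}"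
        using d'(2) that(3) negligible_subset negligible_Un by metis
      then show ?thesis by force
    qed
  qed
qed

section \<open>Functions along absolutely continuous curves\<close>

text \<open>
  On a short interval around \<open>\<tau>\<close> the increment of \<open>W \<circ> x\<close> is, up to an error \<open>e \<integral>\<bar>v\<bar>\<close>, the integral of
  \<open>W'(x(\<theta>)) v(\<theta>)\<close>. Such estimates add up over adjacent intervals, so bisection extends them to \<open>[a,b]\<close>
  and \<open>e\<close> can be sent to \<open>0\<close>. This way no pointwise derivative of \<open>x\<close> is involved.
\<close>

lemma integral_curve_decrease:
  fixes x v :: "real \<Rightarrow> 'a::euclidean_space" and W :: "'a \<Rightarrow> real"
  assumes "a \<le> b" and v: "v absolutely_integrable_on {a..b}"
    and x: "\<And>t. t \<in> {a..b} \<Longrightarrow> x t = x a + integral {a..t} v"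
    and S: "open S" "x ` {a..b} \<subseteq> S"
    and W: "\<And>y. y \<in> S \<Longrightarrow> (W has_derivative blinfun_apply (W' y)) (at y)"
    and W': "continuous_on S W'"
    and N: "negligible N"
    and rate: "\<And>t. t \<in> {a..b} - N \<Longrightarrow> W' (x t) (v t) \<le> - \<delta>"
  shows "W (x b) \<le> W (x a) - \<delta> * (b - a)"
proof -
  have vi: "v integrable_on {a..b}" and ni: "(\<lambda>t. norm (v t)) integrable_on {a..b}"
    using v unfolding absolutely_integrable_on_def by auto
  have cont: "continuous_on {a..b} x"
    by (rule continuous_on_eq[where f="\<lambda>t. x a + integral {a..t} v"])
       (intro continuous_intros indefinite_integral_continuous_1 vi, simp add: x[symmetric])
  have diff: "x t - x s = integral {s..t} v" if "a \<le> s" "s \<le> t" "t \<le> b" for s t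
  proof -
    have "v integrable_on {a..t}" using vi that by (rule_tac integrable_subinterval_real) auto
    then have "integral {a..s} v + integral {s..t} v = integral {a..t} v"
      using that by (intro Henstock_Kurzweil_Integration.integral_combine) auto
    then show ?thesis using x[of s] x[of t] that by (simp add: algebra_simps)
  qed
  \<comment> \<open>half of the error comes from linearising \<open>W\<close> at \<open>x \<tau>\<close>, half from replacing \<open>W' (x \<theta>)\<close>
    by \<open>W' (x \<tau>)\<close> under the integral\<close>
  define P where "P e s t \<longleftrightarrow> (a \<le> s \<and> s \<le> t \<and> t \<le> b \<longrightarrow>
      W (x t) - W (x s) \<le> - \<delta> * (t - s) + e * integral {s..t} (\<lambda>\<theta>. norm (v \<theta>)))" for e s t
  have P: "P e a b" if "e > 0" for e
    using \<open>a \<le> b\<close>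
  proof (induction rule: Bolzano)
    case (trans s r t)
    show ?case
      unfolding P_def
    proof (intro impI)
      assume st: "a \<le> s \<and> s \<le> t \<and> t \<le> b"
      have "(\<lambda>\<theta>. norm (v \<theta>)) integrable_on {s..t}"
        using ni st by (rule_tac integrable_subinterval_real) auto
      then have "integral {s..r} (\<lambda>\<theta>. norm (v \<theta>)) + integral {r..t} (\<lambda>\<theta>. norm (v \<theta>))
          = integral {s..t} (\<lambda>\<theta>. norm (v \<theta>))"
        using trans by (intro Henstock_Kurzweil_Integration.integral_combine) auto
      then have "e * integral {s..t} (\<lambda>\<theta>. norm (v \<theta>)) =
          e * integral {s..r} (\<lambda>\<theta>. norm (v \<theta>)) + e * integral {r..t} (\<lambda>\<theta>. norm (v \<theta>))"
        by (metis distrib_left)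
      then show "W (x t) - W (x s) \<le> - \<delta> * (t - s) + e * integral {s..t} (\<lambda>\<theta>. norm (v \<theta>))"
        using trans st unfolding P_def by (auto simp: algebra_simps)
    qed
  next
    case (local \<tau>)
    then have \<tau>: "\<tau> \<in> {a..b}" by simp
    have "x \<tau> \<in> S" using S(2) \<tau> by blast
    obtain r1 where r1: "r1 > 0" "ball (x \<tau>) r1 \<subseteq> S"
      using S(1) \<open>x \<tau> \<in> S\<close> openE by blast
    obtain r2 where r2: "r2 > 0"
      "\<And>y. y \<in> S \<Longrightarrow> dist y (x \<tau>) < r2 \<Longrightarrow> dist (W' y) (W' (x \<tau>)) < e / 2"
      using W' \<open>x \<tau> \<in> S\<close> \<open>e > 0\<close> unfolding continuous_on_iff by (metis half_gt_zero)
    define U where "U = ball (x \<tau>) (min r1 r2)"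
    have U: "convex U" "U \<subseteq> S" "\<And>y. y \<in> U \<Longrightarrow> norm (W' y - W' (x \<tau>)) \<le> e / 2"
    proof -
      show "convex U" "U \<subseteq> S" using r1 unfolding U_def by auto
      fix y assume y: "y \<in> U"
      then have "y \<in> S" "dist y (x \<tau>) < r2" using r1 unfolding U_def by (auto simp: dist_commute)
      then show "norm (W' y - W' (x \<tau>)) \<le> e / 2"
        using r2(2)[of y] by (simp add: dist_norm)
    qed
    obtain d where d: "d > 0" "\<And>t. t \<in> {a..b} \<Longrightarrow> dist t \<tau> < d \<Longrightarrow> x t \<in> U"
    proof -
      obtain d where "d > 0" "\<And>t. t \<in> {a..b} \<Longrightarrow> dist t \<tau> < d \<Longrightarrow> dist (x t) (x \<tau>) < min r1 r2"
        using cont \<tau> r1 r2 unfolding continuous_on_iff by (metis min_less_iff_conj)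
      then show thesis by (intro that[of d]) (auto simp: U_def dist_commute)
    qed
    show ?case
    proof (intro exI[of _ d] conjI allI impI)
      show "d > 0" by (rule d)
      fix s t assume st: "s \<le> \<tau> \<and> \<tau> \<le> t \<and> t - s < d"
      show "P e s t"
        unfolding P_def
      proof (intro impI)
        assume ab: "a \<le> s \<and> s \<le> t \<and> t \<le> b"
        let ?L = "blinfun_apply (W' (x \<tau>))"
        let ?n = "\<lambda>\<theta>. norm (v \<theta>)"
        have inU: "x \<theta> \<in> U" if "\<theta> \<in> {s..t}" for \<theta>
          using d(2)[of \<theta>] that st ab by (auto simp: dist_real_def)
        have vst: "v integrable_on {s..t}" and nst: "?n integrable_on {s..t}"
          using vi ni ab by (auto intro: integrable_subinterval_real)
        have "norm ((W (x t) - ?L (x t)) - (W (x s) - ?L (x s))) \<le> e / 2 * norm (x t - x s)"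
        proof (rule differentiable_bound[OF U(1), where f' = "\<lambda>y. blinfun_apply (W' y - W' (x \<tau>))"])
          fix y assume y: "y \<in> U"
          have "((\<lambda>y. W y - ?L y) has_derivative (\<lambda>h. W' y h - ?L h)) (at y)"
            using W[of y] y U(2)
            by (intro has_derivative_diff bounded_linear_imp_has_derivative blinfun.bounded_linear_right) auto
          moreover have "blinfun_apply (W' y - W' (x \<tau>)) = (\<lambda>h. W' y h - ?L h)"
            by (auto simp: blinfun.diff_left)
          ultimately show "((\<lambda>y. W y - ?L y) has_derivative blinfun_apply (W' y - W' (x \<tau>))) (at y within U)"
            by (simp only: has_derivative_at_withinI)
          show "onorm (blinfun_apply (W' y - W' (x \<tau>))) \<le> e / 2"
            using U(3)[OF y] by (simp add: norm_blinfun.rep_eq)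
        qed (use inU ab in auto)
        moreover have "norm (x t - x s) \<le> integral {s..t} ?n"
          using diff[of s t] ab integral_norm_bound_integral[OF vst nst] by simp
        then have "e / 2 * norm (x t - x s) \<le> e / 2 * integral {s..t} ?n"
          using \<open>e > 0\<close> by (intro mult_left_mono) auto
        ultimately have 1: "W (x t) - W (x s) \<le> ?L (x t - x s) + e / 2 * integral {s..t} ?n"
          unfolding blinfun.diff_right real_norm_def by linarith
        have "?L (x t - x s) = integral {s..t} (\<lambda>\<theta>. ?L (v \<theta>))"
          using diff[of s t] ab integral_linear[OF vst blinfun.bounded_linear_right, of "W' (x \<tau>)"]
          by (simp add: o_def)
        also have "\<dots> = integral {s..t} (\<lambda>\<theta>. if \<theta> \<in> N then - \<delta> else ?L (v \<theta>))"
          using N by (rule integral_spike) simp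
        also have "\<dots> \<le> integral {s..t} (\<lambda>\<theta>. - \<delta> + e / 2 * ?n \<theta>)"
        proof (rule integral_le)
          have "(\<lambda>\<theta>. ?L (v \<theta>)) integrable_on {s..t}"
            using integrable_linear[OF vst blinfun.bounded_linear_right] by (simp add: o_def)
          then show "(\<lambda>\<theta>. if \<theta> \<in> N then - \<delta> else ?L (v \<theta>)) integrable_on {s..t}"
            by (rule integrable_spike[OF _ N]) simp
          show "(\<lambda>\<theta>. - \<delta> + e / 2 * ?n \<theta>) integrable_on {s..t}"
            by (intro integrable_add integrable_on_mult_right nst integrable_const_ivl)
          fix \<theta> assume \<theta>: "\<theta> \<in> {s..t}"
          show "(if \<theta> \<in> N then - \<delta> else ?L (v \<theta>)) \<le> - \<delta> + e / 2 * ?n \<theta>"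
          proof (cases "\<theta> \<in> N")
            case True then show ?thesis using \<open>e > 0\<close> by simp
          next
            case False
            have "norm (blinfun_apply (W' (x \<theta>) - W' (x \<tau>)) (v \<theta>)) \<le> e / 2 * ?n \<theta>"
              using norm_blinfun[of "W' (x \<theta>) - W' (x \<tau>)" "v \<theta>"] U(3)[OF inU[OF \<theta>]]
              by (smt (verit) mult_right_mono norm_ge_zero)
            moreover have "W' (x \<theta>) (v \<theta>) \<le> - \<delta>" using rate[of \<theta>] False \<theta> ab by auto
            ultimately have "?L (v \<theta>) \<le> - \<delta> + e / 2 * ?n \<theta>"
              unfolding blinfun.diff_left real_norm_def by linarith
            then show ?thesis using False by simp
          qed
        qed
        also have "\<dots> = - \<delta> * (t - s) + e / 2 * integral {s..t} ?n"
          using nst ab by (subst integral_add) (auto intro!: integrable_on_mult_right)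
        finally show "W (x t) - W (x s) \<le> - \<delta> * (t - s) + e * integral {s..t} ?n"
          using 1 by (simp add: field_simps)
      qed
    qed
  qed
  have "W (x b) - W (x a) + \<delta> * (b - a) \<le> 0 + e" if "e > 0" for e
  proof -
    let ?I = "integral {a..b} (\<lambda>\<theta>. norm (v \<theta>))"
    have I: "?I \<ge> 0" by (rule integral_nonneg[OF ni]) simp
    have "e / (?I + 1) > 0" using that I by simp
    from P[OF this] have "W (x b) - W (x a) + \<delta> * (b - a) \<le> e / (?I + 1) * ?I"
      using \<open>a \<le> b\<close> unfolding P_def by simp
    also have "\<dots> \<le> e" using that I by (simp add: field_simps)
    finally show ?thesis by simp
  qed
  then have "W (x b) - W (x a) + \<delta> * (b - a) \<le> 0" by (rule field_le_epsilon)
  then show ?thesis by simp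
qed

text \<open>
  The chain rule for a rescaling \<open>\<psi>\<close> of \<open>V\<close>. The choices \<open>\<psi>(s) = s\<^bsup>1-\<alpha>\<^esup>\<close> and \<open>\<psi>(s) = ln s\<close> turn
  \<open>V' \<le> - c V\<^sup>\<alpha>\<close> into linear decrease, the first at a rate independent of the size of \<open>V\<close>, the second in
  a form that can be compared with the relative decay of \<open>\<eta>\<close>.
\<close>

lemma rescaled_Lyapunov_decrease:
  fixes x v :: "real \<Rightarrow> 'a::euclidean_space" and V :: "'a \<Rightarrow> real"
  assumes "a \<le> b" and v: "v absolutely_integrable_on {a..b}"
    and x: "\<And>t. t \<in> {a..b} \<Longrightarrow> x t = x a + integral {a..t} v"
    and nz: "\<And>t. t \<in> {a..b} \<Longrightarrow> x t \<noteq> 0"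
    and V: "\<And>y. y \<noteq> 0 \<Longrightarrow> V y > 0"
      "\<And>y. y \<noteq> 0 \<Longrightarrow> (V has_derivative blinfun_apply (V' y)) (at y)" "continuous_on (- {0}) V'"
    and \<psi>: "\<And>s. s > 0 \<Longrightarrow> (\<psi> has_real_derivative \<psi>' s) (at s)" "continuous_on {0<..} \<psi>'"
    and N: "negligible N"
    and rate: "\<And>t. t \<in> {a..b} - N \<Longrightarrow> \<psi>' (V (x t)) * V' (x t) (v t) \<le> - \<delta>"
  shows "\<psi> (V (x b)) \<le> \<psi> (V (x a)) - \<delta> * (b - a)"
proof (rule integral_curve_decrease[OF \<open>a \<le> b\<close> v x, of "- {0}"
      "\<lambda>y. \<psi> (V y)" "\<lambda>y. \<psi>' (V y) *\<^sub>R V' y"])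
  have "continuous_on (- {0}) V"
    using V(2) by (intro continuous_at_imp_continuous_on) (auto intro: has_derivative_continuous)
  then have "continuous_on (- {0}) (\<lambda>y. \<psi>' (V y))"
    by (rule continuous_on_compose2[OF \<psi>(2)]) (use V(1) in auto)
  then show "continuous_on (- {0}) (\<lambda>y. \<psi>' (V y) *\<^sub>R V' y)"
    by (intro continuous_on_scaleR V(3))
  fix y :: 'a assume y: "y \<in> - {0}"
  have "(\<psi> has_derivative (*) (\<psi>' (V y))) (at (V y))"
    using \<psi>(1)[of "V y"] V(1)[of y] y by (simp add: has_field_derivative_def)
  from has_derivative_compose[OF V(2) this] y
  show "((\<lambda>y. \<psi> (V y)) has_derivative blinfun_apply (\<psi>' (V y) *\<^sub>R V' y)) (at y)"
    by (simp add: scaleR_blinfun.rep_eq)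
qed (use nz N rate in \<open>auto simp: blinfun.scaleR_left\<close>)

lemma Lyapunov_powr_decrease:
  fixes x v :: "real \<Rightarrow> 'a::euclidean_space" and V :: "'a \<Rightarrow> real"
  assumes "a \<le> b" and v: "v absolutely_integrable_on {a..b}"
    and x: "\<And>t. t \<in> {a..b} \<Longrightarrow> x t = x a + integral {a..t} v"
    and nz: "\<And>t. t \<in> {a..b} \<Longrightarrow> x t \<noteq> 0"
    and V: "\<And>y. y \<noteq> 0 \<Longrightarrow> V y > 0"
      "\<And>y. y \<noteq> 0 \<Longrightarrow> (V has_derivative blinfun_apply (V' y)) (at y)" "continuous_on (- {0}) V'"
    and N: "negligible N" and "\<alpha> < 1"
    and rate: "\<And>t. t \<in> {a..b} - N \<Longrightarrow> V' (x t) (v t) \<le> - (c * V (x t) powr \<alpha>)"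
  shows "V (x b) powr (1 - \<alpha>) \<le> V (x a) powr (1 - \<alpha>) - (1 - \<alpha>) * c * (b - a)"
proof (rule rescaled_Lyapunov_decrease[OF \<open>a \<le> b\<close> v x nz V, where \<psi>' = "\<lambda>s. (1 - \<alpha>) * s powr (- \<alpha>)"])
  fix s :: real assume "s > 0"
  then show "((\<lambda>s. s powr (1 - \<alpha>)) has_real_derivative (1 - \<alpha>) * s powr (- \<alpha>)) (at s)"
    using has_real_derivative_powr[of s "1 - \<alpha>"] by simp
next
  show "continuous_on {0<..} (\<lambda>s. (1 - \<alpha>) * s powr (- \<alpha>))"
    by (intro continuous_intros) auto
next
  fix t assume t: "t \<in> {a..b} - N"
  have "V (x t) > 0" using t by (intro V(1) nz) auto
  have "V (x t) powr (- \<alpha>) * V' (x t) (v t) \<le> V (x t) powr (- \<alpha>) * (- (c * V (x t) powr \<alpha>))"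
    by (intro mult_left_mono rate t) simp
  also have "\<dots> = - c" using \<open>V (x t) > 0\<close> by (simp add: powr_minus)
  finally have "(1 - \<alpha>) * (V (x t) powr (- \<alpha>) * V' (x t) (v t)) \<le> (1 - \<alpha>) * (- c)"
    using \<open>\<alpha> < 1\<close> by (intro mult_left_mono) auto
  then show "(1 - \<alpha>) * V (x t) powr (- \<alpha>) * V' (x t) (v t) \<le> - ((1 - \<alpha>) * c)"
    by (simp add: mult.assoc)
qed (use N in auto)

lemma Lyapunov_ln_decrease:
  fixes x v :: "real \<Rightarrow> 'a::euclidean_space" and V :: "'a \<Rightarrow> real"
  assumes "a \<le> b" and v: "v absolutely_integrable_on {a..b}"
    and x: "\<And>t. t \<in> {a..b} \<Longrightarrow> x t = x a + integral {a..t} v"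
    and nz: "\<And>t. t \<in> {a..b} \<Longrightarrow> x t \<noteq> 0"
    and V: "\<And>y. y \<noteq> 0 \<Longrightarrow> V y > 0"
      "\<And>y. y \<noteq> 0 \<Longrightarrow> (V has_derivative blinfun_apply (V' y)) (at y)" "continuous_on (- {0}) V'"
    and N: "negligible N" and "\<alpha> < 1" and "c > 0"
    and rate: "\<And>t. t \<in> {a..b} - N \<Longrightarrow> V' (x t) (v t) \<le> - (c * V (x t) powr \<alpha>)"
    and le: "\<And>t. t \<in> {a..b} \<Longrightarrow> V (x t) \<le> \<epsilon>"
  shows "ln (V (x b)) \<le> ln (V (x a)) - c * \<epsilon> powr (\<alpha> - 1) * (b - a)"
proof (rule rescaled_Lyapunov_decrease[OF \<open>a \<le> b\<close> v x nz V, where \<psi>' = "\<lambda>s. 1 / s"])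
  fix s :: real assume "s > 0"
  then show "(ln has_real_derivative 1 / s) (at s)"
    using DERIV_ln[of s] by (simp add: inverse_eq_divide)
next
  show "continuous_on {0<..} (\<lambda>s :: real. 1 / s)"
    by (intro continuous_intros) auto
next
  fix t assume t: "t \<in> {a..b} - N"
  have "V (x t) > 0" using t by (intro V(1) nz) auto
  have "1 / V (x t) * V' (x t) (v t) \<le> 1 / V (x t) * (- (c * V (x t) powr \<alpha>))"
    using \<open>V (x t) > 0\<close> by (intro mult_left_mono rate t) simp
  also have "\<dots> = - (c * V (x t) powr (\<alpha> - 1))" using \<open>V (x t) > 0\<close> by (simp add: powr_diff)
  also have "\<dots> \<le> - (c * \<epsilon> powr (\<alpha> - 1))"
    using \<open>V (x t) > 0\<close> \<open>\<alpha> < 1\<close> \<open>c > 0\<close> le[of t] t by (simp add: powr_mono2')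
  finally show "1 / V (x t) * V' (x t) (v t) \<le> - (c * \<epsilon> powr (\<alpha> - 1))" .
qed (use N in auto)


lemma ln_decay_rate:
  fixes \<eta> :: "real \<Rightarrow> real"
  assumes pos: "\<And>t. t \<ge> 0 \<Longrightarrow> \<eta> t > 0" and C1: "C1_on {0..} \<eta>"
    and rate: "\<And>t. t \<ge> 0 \<Longrightarrow> - vector_derivative \<eta> (at t within {0..}) \<le> M * \<eta> t"
    and ab: "0 \<le> a" "a \<le> b"
  shows "ln (\<eta> a) - M * (b - a) \<le> ln (\<eta> b)"
proof -
  obtain \<eta>' where \<eta>': "\<And>t. t \<ge> 0 \<Longrightarrow> (\<eta> has_derivative blinfun_apply (\<eta>' t)) (at t within {0..})"
    using C1 unfolding C1_on_def by auto
  have cont: "continuous_on {a..b} \<eta>"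
  proof (rule continuous_on_subset)
    show "continuous_on {0..} \<eta>"
      using \<eta>' by (intro has_derivative_continuous_on[where f' = "\<lambda>t. blinfun_apply (\<eta>' t)"]) auto
  qed (use ab in auto)
  have "ln (\<eta> a) + M * a \<le> ln (\<eta> b) + M * b"
  proof (rule DERIV_nonneg_imp_increasing_open[OF ab(2)])
    show "continuous_on {a..b} (\<lambda>t. ln (\<eta> t) + M * t)"
      using pos ab by (intro continuous_intros cont) (simp add: less_imp_neq[symmetric])
    fix t assume t: "a < t" "t < b"
    then have "t > 0" using ab by simp
    have "at t within {0..} = at t"
      by (rule at_within_interior) (use \<open>t > 0\<close> in simp)
    then have "(\<eta> has_derivative blinfun_apply (\<eta>' t)) (at t)" using \<eta>'[of t] \<open>t > 0\<close> by simp
    moreover have "blinfun_apply (\<eta>' t) = (\<lambda>h. h *\<^sub>R \<eta>' t 1)"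
    proof
      fix h show "blinfun_apply (\<eta>' t) h = h *\<^sub>R \<eta>' t 1"
        using blinfun.scaleR_right[of "\<eta>' t" h 1] by simp
    qed
    ultimately have d: "(\<eta> has_vector_derivative \<eta>' t 1) (at t)"
      by (simp add: has_vector_derivative_def)
    then have "- \<eta>' t 1 \<le> M * \<eta> t"
      using rate[of t] \<open>t > 0\<close> \<open>at t within {0..} = at t\<close> by (simp add: vector_derivative_at)
    then have "\<eta>' t 1 / \<eta> t + M \<ge> 0"
      using pos[of t] \<open>t > 0\<close> by (simp add: field_simps)
    moreover have "((\<lambda>t. ln (\<eta> t) + M * t) has_field_derivative \<eta>' t 1 / \<eta> t + M) (at t)"
      using d pos[of t] \<open>t > 0\<close> unfolding has_real_derivative_iff_has_vector_derivative[symmetric]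
      by (auto intro!: derivative_eq_intros)
    ultimately show "\<exists>y. ((\<lambda>t. ln (\<eta> t) + M * t) has_field_derivative y) (at t) \<and> 0 \<le> y"
      by blast
  qed
  then show ?thesis by (simp add: algebra_simps)
qed

text \<open>
  If \<open>f/\<eta>\<close> stayed above \<open>\<rho>\<close> forever, its logarithm would fall below \<open>ln \<rho>\<close>; so it gets down to \<open>\<rho>\<close>.
  If it exceeded \<open>\<rho>\<close> again at \<open>t\<close>, it would equal \<open>\<rho>\<close> at the last earlier time at which it was at most
  \<open>\<rho>\<close>, and decrease from then on.
\<close>

lemma eventually_below_ratio:
  fixes f \<eta> :: "real \<Rightarrow> real"
  assumes cont: "continuous_on {T..} f" "continuous_on {T..} \<eta>"
    and pos: "\<And>t. t \<ge> T \<Longrightarrow> \<eta> t > 0" and "\<rho> > 0" and "\<delta> > 0"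
    and decrease: "\<And>a b. T \<le> a \<Longrightarrow> a \<le> b \<Longrightarrow> (\<And>t. t \<in> {a..b} \<Longrightarrow> \<rho> * \<eta> t \<le> f t) \<Longrightarrow>
      ln (f b) - ln (\<eta> b) \<le> ln (f a) - ln (\<eta> a) - \<delta> * (b - a)"
  shows "\<exists>t1\<ge>T. \<forall>t\<ge>t1. f t \<le> \<rho> * \<eta> t"
proof -
  have "\<exists>t1\<ge>T. f t1 \<le> \<rho> * \<eta> t1"
  proof (rule ccontr)
    assume "\<not> ?thesis"
    then have above: "f t > \<rho> * \<eta> t" if "t \<ge> T" for t using that by (meson not_le)
    define b where "b = T + (\<bar>ln (f T) - ln (\<eta> T) - ln \<rho>\<bar> + 1) / \<delta>"
    have "b \<ge> T" using \<open>\<delta> > 0\<close> by (simp add: b_def)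
    have "\<rho> * \<eta> b > 0" using \<open>\<rho> > 0\<close> pos[OF \<open>b \<ge> T\<close>] by simp
    then have "ln (\<rho> * \<eta> b) \<le> ln (f b)" using above[OF \<open>b \<ge> T\<close>] by (simp add: less_imp_le)
    then have "ln \<rho> \<le> ln (f b) - ln (\<eta> b)"
      using \<open>\<rho> > 0\<close> pos[OF \<open>b \<ge> T\<close>] by (simp add: ln_mult)
    also have "\<dots> \<le> ln (f T) - ln (\<eta> T) - \<delta> * (b - T)"
      using above \<open>b \<ge> T\<close> by (intro decrease) (auto intro: less_imp_le)
    also have "\<delta> * (b - T) = \<bar>ln (f T) - ln (\<eta> T) - ln \<rho>\<bar> + 1"
      using \<open>\<delta> > 0\<close> by (simp add: b_def)
    finally show False by linarith
  qed
  then obtain t1 where t1: "t1 \<ge> T" "f t1 \<le> \<rho> * \<eta> t1" by blast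
  have "f t \<le> \<rho> * \<eta> t" if "t \<ge> t1" for t
  proof (rule ccontr)
    assume t: "\<not> f t \<le> \<rho> * \<eta> t"
    define h where "h \<tau> = f \<tau> - \<rho> * \<eta> \<tau>" for \<tau>
    have conth: "continuous_on {a..t} h" if "a \<ge> t1" for a
      unfolding h_def
      by (intro continuous_intros; rule continuous_on_subset[OF cont(1)] continuous_on_subset[OF cont(2)])
        (use that t1 in auto)
    define Z where "Z = {t1..t} \<inter> h -` {..0}"
    have "closed Z" unfolding Z_def
      by (intro continuous_closed_preimage conth) auto
    moreover have "Z \<noteq> {}" using t1 that by (auto simp: Z_def h_def)
    moreover have bdd: "bdd_above Z" by (auto simp: Z_def)
    ultimately have "Sup Z \<in> Z" by (intro closed_contains_Sup)
    define s where "s = Sup Z"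
    have s: "t1 \<le> s" "s \<le> t" "h s \<le> 0" using \<open>Sup Z \<in> Z\<close> by (auto simp: s_def Z_def)
    have after: "h \<tau> > 0" if "s < \<tau>" "\<tau> \<le> t" for \<tau>
    proof (rule ccontr)
      assume "\<not> h \<tau> > 0"
      then have "\<tau> \<in> Z" using that s by (auto simp: Z_def)
      then show False using cSup_upper[OF \<open>\<tau> \<in> Z\<close> bdd] that(1) by (simp add: s_def)
    qed
    have "h t > 0" using t by (simp add: h_def)
    then obtain s' where s': "s \<le> s'" "s' \<le> t" "h s' = 0"
      using IVT'[of h s 0 t] s conth[of s] by auto
    then have "h s = 0" using after[of s'] by (cases "s = s'") auto
    have "ln (f t) - ln (\<eta> t) \<le> ln (f s) - ln (\<eta> s) - \<delta> * (t - s)"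
    proof (rule decrease)
      fix \<tau> assume \<tau>: "\<tau> \<in> {s..t}"
      then show "\<rho> * \<eta> \<tau> \<le> f \<tau>"
        using after[of \<tau>] \<open>h s = 0\<close> unfolding h_def by (cases "\<tau> = s") auto
    qed (use s t1 in auto)
    also have "ln (f s) - ln (\<eta> s) = ln \<rho>"
      using \<open>h s = 0\<close> \<open>\<rho> > 0\<close> pos[of s] s t1 by (simp add: h_def ln_mult)
    finally have "ln (f t) - ln (\<eta> t) \<le> ln \<rho> - \<delta> * (t - s)" .
    moreover have "\<delta> * (t - s) \<ge> 0" using \<open>\<delta> > 0\<close> s by simp
    ultimately have le: "ln (f t) \<le> ln \<rho> + ln (\<eta> t)" by linarith
    have "\<eta> t > 0" using pos[of t] that t1 by simp
    then have "f t > 0" using t mult_pos_pos[OF \<open>\<rho> > 0\<close> \<open>\<eta> t > 0\<close>] by linarith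
    have "ln (f t) \<le> ln (\<rho> * \<eta> t)" using le \<open>\<rho> > 0\<close> \<open>\<eta> t > 0\<close> by (simp add: ln_mult)
    then show False using t \<open>f t > 0\<close> mult_pos_pos[OF \<open>\<rho> > 0\<close> \<open>\<eta> t > 0\<close>] by simp
  qed
  then show ?thesis using t1(1) by blast
qed

section \<open>Homogeneity with respect to the weighted dilations\<close>

lemma pos_bounds: "1 \<le> pos (i::'n::{finite,linorder})" "pos (i::'n) \<le> CARD('n)"
proof -
  have "card {i} \<le> pos i" unfolding pos_def by (intro card_mono) auto
  then show "1 \<le> pos i" by simp
  show "pos i \<le> CARD('n)" unfolding pos_def by (intro card_mono) auto
qed

lemma ex_last_pos: "\<exists>i::'n::{finite,linorder}. pos i = CARD('n)"
proof
  have "{j::'n. j \<le> Max UNIV} = UNIV" by auto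
  then show "pos (Max UNIV :: 'n) = CARD('n)" unfolding pos_def by simp
qed

text \<open>
  The last component of the nominal field is \<open>u\<^sub>0\<close> itself and carries the weight \<open>p + (r-1)\<kappa>\<close>, to which the
  degree \<open>\<kappa>\<close> of the field is added.
\<close>

lemma nominal_field_homogeneous_imp:
  fixes u0 :: "real^'n::{finite,linorder} \<Rightarrow> real"
  assumes "homogeneous_field p \<kappa> \<kappa> (nominal_field u0)"
  shows "homogeneous_fun p \<kappa> (p + real CARD('n) * \<kappa>) u0"
  unfolding homogeneous_fun_def
proof (intro allI impI)
  fix l :: real and z :: "real^'n::_" assume "l > 0"
  obtain i :: 'n where i: "pos i = CARD('n)" using ex_last_pos by blast
  have last: "nominal_field u0 y $ i = u0 y" for y
  proof -
    have "(Jr *v y) $ i = 0"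
      unfolding matrix_vector_mult_def Jr_def
      by (simp add: i) (intro sum.neutral, use pos_bounds(2) in \<open>metis Suc_n_not_le_n mult_zero_left\<close>)
    then show ?thesis by (simp add: nominal_field_def er_def i)
  qed
  have "nominal_field u0 (dil p \<kappa> l z) $ i = (l powr \<kappa> *\<^sub>R dil p \<kappa> l (nominal_field u0 z)) $ i"
    using assms \<open>l > 0\<close> unfolding homogeneous_field_def by simp
  then have "u0 (dil p \<kappa> l z) = l powr \<kappa> * (l powr (p + (real CARD('n) - 1) * \<kappa>) * u0 z)"
    by (simp add: last dil_def i)
  also have "\<dots> = l powr (\<kappa> + (p + (real CARD('n) - 1) * \<kappa>)) * u0 z"
    by (simp add: powr_add)
  finally show "u0 (dil p \<kappa> l z) = l powr (p + real CARD('n) * \<kappa>) *\<^sub>R u0 z"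
    by (simp add: algebra_simps)
qed

text \<open>
  A function that is homogeneous of two different degrees vanishes, so the positive value that \<open>M_u0\<close>
  may take in degree zero does not occur here.
\<close>

lemma M_u0_eq_0:
  fixes u0 :: "real^'n::{finite,linorder} \<Rightarrow> real"
  assumes hom: "homogeneous_fun p \<kappa> q u0" and "q \<noteq> 0"
  shows "M_u0 p \<kappa> g u0 = 0"
proof (cases "homogeneous_fun p \<kappa> 0 u0")
  case True
  have "u0 y = 0" for y
  proof -
    have "2 powr q * u0 y = 2 powr 0 * u0 y"
      using hom True unfolding homogeneous_fun_def by (metis real_scaleR_def zero_less_numeral)
    moreover have "2 powr q \<noteq> (2 powr 0 :: real)" using \<open>q \<noteq> 0\<close> by (subst powr_inj) auto
    ultimately show ?thesis by simp
  qed
  then show ?thesis by (simp add: M_u0_def)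
qed (simp add: M_u0_def)

lemma linear_dil: "linear (dil p \<kappa> l)"
  by (intro linearI) (simp_all add: dil_def vec_eq_iff algebra_simps)

lemma dil_inverse: "l > 0 \<Longrightarrow> dil p \<kappa> l (dil p \<kappa> (1 / l) z) = z"
  by (simp add: dil_def vec_eq_iff powr_divide)

text \<open>
  The essential bound \<open>B\<close> on the unit ball becomes \<open>l\<^sup>q B\<close> on its image under the dilation by \<open>l\<close>, which is a
  neighbourhood of the origin; the exceptional set stays negligible because the dilation is linear.
\<close>

lemma homogeneous_essentially_small:
  fixes f :: "real^'n::{finite,linorder} \<Rightarrow> real"
  assumes hom: "homogeneous_fun p \<kappa> q f" and "q > 0" and "locally_ess_bounded f" and "e > 0"
  shows "\<exists>d>0. \<exists>N. negligible N \<and> (\<forall>y. norm y < d \<longrightarrow> y \<notin> N \<longrightarrow> \<bar>f y\<bar> \<le> e)"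
proof -
  obtain B where "AE x in lebesgue. norm x \<le> 1 \<longrightarrow> norm (f x) \<le> B"
    using assms(3) unfolding locally_ess_bounded_def by blast
  then obtain N where N: "negligible N" "\<And>x. x \<notin> N \<Longrightarrow> norm x \<le> 1 \<Longrightarrow> \<bar>f x\<bar> \<le> B"
    unfolding eventually_ae_filter_negligible by auto
  define C where "C = max B 1"
  define l where "l = (e / C) powr (1 / q)"
  have "C > 0" "l > 0" using \<open>e > 0\<close> by (auto simp: C_def l_def)
  have lq: "l powr q * C = e"
    using \<open>q > 0\<close> \<open>C > 0\<close> \<open>e > 0\<close> by (simp add: l_def powr_powr)
  obtain K where K: "K > 0" "\<And>y. norm (dil p \<kappa> (1 / l) y :: real^'n::_) \<le> K * norm y"
    using linear_bounded_pos[OF linear_dil[of p \<kappa> "1 / l"]] by auto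
  show ?thesis
  proof (intro exI[of _ "1 / K"] exI[of _ "dil p \<kappa> l ` N"] conjI allI impI)
    show "1 / K > 0" using K by simp
    show "negligible (dil p \<kappa> l ` N)"
      by (intro negligible_differentiable_image_negligible N(1) order_refl
          linear_imp_differentiable_on linear_dil)
    fix y :: "real^'n::_" assume y: "norm y < 1 / K" "y \<notin> dil p \<kappa> l ` N"
    define x where "x = dil p \<kappa> (1 / l) y"
    have yx: "y = dil p \<kappa> l x" using \<open>l > 0\<close> by (simp add: x_def dil_inverse)
    then have "x \<notin> N" using y(2) by blast
    moreover have "norm x \<le> 1"
      using K(2)[of y] y(1) K(1) by (simp add: x_def field_simps)
    ultimately have "\<bar>f x\<bar> \<le> C" using N(2)[of x] by (simp add: C_def)
    moreover have "\<bar>f y\<bar> = l powr q * \<bar>f x\<bar>"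
      using hom \<open>l > 0\<close> unfolding yx homogeneous_fun_def by (simp add: abs_mult)
    ultimately show "\<bar>f y\<bar> \<le> e"
      using lq by (metis mult_left_mono powr_ge_zero)
  qed
qed

text \<open>
  Contracting a point outside the ball of radius \<open>r\<close> by dilations moves it through the sphere of radius \<open>r\<close>
  without increasing \<open>V\<close>. So outside the ball \<open>V\<close> is at least its minimum over the sphere.
\<close>

lemma homogeneous_small_imp_small:
  fixes V :: "real^'n::{finite,linorder} \<Rightarrow> real"
  assumes hom: "homogeneous_fun p \<kappa> q V" and "q > 0" and cont: "continuous_on UNIV V"
    and pos: "\<And>x. x \<noteq> 0 \<Longrightarrow> V x > 0"
    and weights: "\<And>i::'n. p + (real (pos i) - 1) * \<kappa> > 0" and "r > 0"
  shows "\<exists>m>0. \<forall>y. V y < m \<longrightarrow> norm y < r"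
proof -
  have "\<exists>x\<in>sphere (0::real^'n::_) r. \<forall>y\<in>sphere 0 r. V x \<le> V y"
    using \<open>r > 0\<close> by (intro continuous_attains_inf continuous_on_subset[OF cont]) auto
  then obtain x0 :: "real^'n::_" where x0: "norm x0 = r" "\<And>y. norm y = r \<Longrightarrow> V x0 \<le> V y"
    by auto
  show ?thesis
  proof (intro exI[of _ "V x0"] conjI allI impI)
    show "V x0 > 0" using x0 \<open>r > 0\<close> by (intro pos) auto
    fix y assume "V y < V x0"
    show "norm y < r"
    proof (rule ccontr)
      assume "\<not> norm y < r"
      have "continuous_on {0..1} (\<lambda>l. norm (dil p \<kappa> l y))"
        unfolding dil_def
        by (intro continuous_intros continuous_on_powr') (use weights in auto)
      moreover have "norm (dil p \<kappa> 0 y) \<le> r" "r \<le> norm (dil p \<kappa> 1 y)"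
        using \<open>\<not> norm y < r\<close> \<open>r > 0\<close> by (simp_all add: dil_def vec_lambda_unique zero_vec_def[symmetric])
      ultimately obtain l where l: "0 \<le> l" "l \<le> 1" "norm (dil p \<kappa> l y) = r"
        using IVT'[of "\<lambda>l. norm (dil p \<kappa> l y)" 0 r 1] by auto
      have "l \<noteq> 0" using l(3) \<open>r > 0\<close> by (auto simp: dil_def zero_vec_def[symmetric])
      then have "V (dil p \<kappa> l y) = l powr q * V y"
        using hom l(1) unfolding homogeneous_fun_def by simp
      moreover have "l powr q \<le> 1" using l(1,2) \<open>q > 0\<close> by (simp add: powr_le1)
      moreover have "V y > 0" using \<open>\<not> norm y < r\<close> \<open>r > 0\<close> by (intro pos) auto
      ultimately have "V (dil p \<kappa> l y) \<le> V y"
        using mult_right_mono[of "l powr q" 1 "V y"] by simp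
      then show False using x0(2)[OF l(3)] \<open>V y < V x0\<close> by simp
    qed
  qed
qed

section \<open>Decrease of the Lyapunov function under a dominating gain\<close>

text \<open>
  The function under the infimum is bounded below: it is nonnegative once \<open>\<gamma>\<^sub>m g \<ge> 1\<close>, and
  never below \<open>-x\<close>. So the infimum is a genuine lower bound.
\<close>

lemma hm_le:
  assumes "\<gamma>m > 0" and g: "\<And>x. x \<ge> 0 \<Longrightarrow> g x > 0" and lim: "filterlim g at_top at_top" and "x \<ge> 0"
  shows "hm \<gamma>m g \<le> x * (\<gamma>m * g x - 1)"
proof -
  obtain X where X: "\<And>x. x \<ge> X \<Longrightarrow> g x \<ge> 1 / \<gamma>m"
    using lim unfolding filterlim_at_top eventually_at_top_linorder by blast
  have "bdd_below ((\<lambda>x. x * (\<gamma>m * g x - 1)) ` {0..})"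
  proof (rule bdd_belowI2)
    fix y :: real assume y: "y \<in> {0..}"
    show "- max X 0 \<le> y * (\<gamma>m * g y - 1)"
    proof (cases "y \<ge> X")
      case True
      then have "\<gamma>m * g y \<ge> 1" using X[of y] \<open>\<gamma>m > 0\<close> by (simp add: field_simps)
      then show ?thesis using y by (smt (verit) atLeast_iff mult_nonneg_nonneg)
    next
      case False
      have "y * (\<gamma>m * g y) \<ge> 0" using g[of y] y \<open>\<gamma>m > 0\<close> by simp
      then show ?thesis using False by (simp add: algebra_simps)
    qed
  qed
  then have "(INF x\<in>{0..}. x * (\<gamma>m * g x - 1)) \<le> x * (\<gamma>m * g x - 1)"
    using \<open>x \<ge> 0\<close> by (intro cINF_lower) auto
  then show ?thesis unfolding hm_def by simp
qed

text \<open>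
  Write \<open>D\<close> for the last partial derivative of \<open>V\<close> at \<open>z\<close>. If \<open>D \<noteq> 0\<close>, then by continuity and the sign
  conditions \<open>u\<^sub>0\<close> has the constant sign \<open>\<sigma> = - sgn D\<close> near \<open>z\<close>. At nearby points \<open>y\<close> the control pushes in
  direction \<open>\<sigma>\<close> with strength at least \<open>\<bar>u\<^sub>0(y)\<bar> + h + k \<gamma>\<^sub>m \<Gamma>(y)\<close>, which by the condition on the gain covers
  the perturbation and leaves \<open>\<bar>u\<^sub>0(y)\<bar>\<close>. Almost everywhere this is nearly above the essential limit inferior
  \<open>a\<close> of \<open>\<sigma> u\<^sub>0\<close> at \<open>z\<close>, and the velocity with nominal control \<open>\<sigma> a\<close> is a Filippov velocity of the nominal
  system, for which the decrease is known. If \<open>D = 0\<close>, the form \<open>dV(z)\<close> does not see the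
  control, and the comparison with that nominal velocity is immediate.
\<close>

lemma velocity_decreases:
  fixes u0 V :: "real^'n::{finite,linorder} \<Rightarrow> real" and z v :: "real^'n::_"
  assumes "z \<noteq> 0"
    and V': "\<And>x. x \<noteq> 0 \<Longrightarrow> (V has_derivative blinfun_apply (V' x)) (at x)"
      "continuous_on (- {0}) V'"
    and u0: "locally_ess_bounded u0"
    and nominal: "\<And>d. d \<in> orbital_derivatives (nominal_field u0) V z \<Longrightarrow> d \<le> - R"
    and sign: "\<And>x. x \<noteq> 0 \<Longrightarrow> u0 x * dV_last V x \<le> 0"
      "\<And>x. x \<noteq> 0 \<Longrightarrow> u0 x = 0 \<Longrightarrow> dV_last V x = 0"
    and pert: "\<bar>\<phi>t\<bar> \<le> \<phi>b" "\<gamma>m > 0" "\<gamma>m \<le> \<gamma>t" and "k > 0"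
    and g: "\<And>x. x \<ge> 0 \<Longrightarrow> g x > 0"
    and h: "\<And>x. x \<ge> 0 \<Longrightarrow> h \<le> x * (\<gamma>m * g x - 1)"
    and gain: "isCont \<Gamma> z" "\<Gamma> z > 0" "k * \<gamma>m * \<Gamma> z \<ge> \<phi>b - h"
    and v: "v \<in> filippov (\<lambda>y. (\<lambda>u. Jr *v y + (\<phi>t + \<gamma>t * u) *\<^sub>R er) `
              {g \<bar>u0 y\<bar> * u0 y + k * s * \<Gamma> y | s. s \<in> msgn (u0 y)}) z"
  shows "V' z v \<le> - R"
proof -
  define D where "D = V' z er"
  define \<sigma> where "\<sigma> = (if D = 0 then 1 else - sgn D)"
  have \<sigma>: "\<bar>\<sigma>\<bar> = 1" "\<sigma> * \<sigma> = 1" "D = - \<sigma> * \<bar>D\<bar>"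
    unfolding \<sigma>_def by (auto simp: sgn_if)
  have dV: "dV_last V x = V' x er" "frechet_derivative V (at x) = blinfun_apply (V' x)" if "x \<noteq> 0" for x
    using frechet_derivative_at[OF V'(1)[OF that]] unfolding dV_last_def by simp_all
  have contV': "isCont V' z"
    using V'(2) \<open>z \<noteq> 0\<close> by (simp add: continuous_on_eq_continuous_at[OF open_Compl[OF closed_singleton]])
  have ess: "locally_ess_bounded (\<lambda>y. \<sigma> * u0 y)"
    using u0 \<sigma>(1) unfolding locally_ess_bounded_def by (simp add: abs_mult)
  obtain a where
    a: "\<And>e. e > 0 \<Longrightarrow> \<exists>d>0. negligible {y \<in> ball z d. \<sigma> * u0 y < a - e}"
       "\<And>e d N. e > 0 \<Longrightarrow> d > 0 \<Longrightarrow> negligible N \<Longrightarrow> \<exists>y\<in>ball z d - N. \<bar>\<sigma> * u0 y - a\<bar> \<le> e"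
    using essential_infimum_at_point[OF ess, of z] by blast
  have contJ: "isCont (\<lambda>y. Jr *v y) (z :: real^'n::_)"
    by (intro linear_continuous_at matrix_vector_mul_bounded_linear)
  \<comment> \<open>\<open>\<sigma> a\<close> is an essential cluster value of \<open>u\<^sub>0\<close>, so it yields a nominal Filippov velocity\<close>
  have "Jr *v z + (\<sigma> * a) *\<^sub>R er \<in> filippov (\<lambda>y. {nominal_field u0 y}) z"
    unfolding filippov_def
  proof (intro INT_I)
    fix d :: real and N :: "(real^'n::_) set" assume "d \<in> {0<..}" and "N \<in> {N. negligible N}"
    then have dN: "d > 0" "negligible N" by auto
    let ?U = "\<Union>y\<in>ball z d - N. {nominal_field u0 y}"
    have "Jr *v z + (\<sigma> * a) *\<^sub>R er \<in> closure ?U"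
      unfolding closure_approachable
    proof (intro allI impI)
      fix e :: real assume "e > 0"
      define e' where "e' = e / (2 * (norm (er :: real^'n::_) + 1))"
      have e': "e' > 0" "e' * norm (er :: real^'n::_) < e / 2"
        using \<open>e > 0\<close> by (simp_all add: e'_def field_simps add_pos_nonneg)
      obtain d' where d': "d' > 0" "\<And>y. dist y z < d' \<Longrightarrow> dist (Jr *v y) (Jr *v z :: real^'n::_) < e / 2"
        using contJ \<open>e > 0\<close> unfolding continuous_at_eps_delta by (metis half_gt_zero)
      obtain y where y: "y \<in> ball z (min d d') - N" "\<bar>\<sigma> * u0 y - a\<bar> \<le> e'"
        using a(2)[of e' "min d d'" N] e'(1) d' dN by auto
      have "norm ((u0 y - \<sigma> * a) *\<^sub>R (er :: real^'n::_)) \<le> e' * norm (er :: real^'n::_)"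
      proof -
        have "u0 y - \<sigma> * a = \<sigma> * (\<sigma> * u0 y - a)" using \<sigma>(2) by (simp add: algebra_simps)
        then have "\<bar>u0 y - \<sigma> * a\<bar> \<le> e'" using y(2) \<sigma>(1) by (simp add: abs_mult)
        then show ?thesis by (simp add: mult_right_mono)
      qed
      moreover have "norm (Jr *v y - Jr *v z) < e / 2"
        using d'(2)[of y] y(1) by (simp add: dist_norm norm_minus_commute)
      moreover have eq: "nominal_field u0 y - (Jr *v z + (\<sigma> * a) *\<^sub>R er) =
          (Jr *v y - Jr *v z) + (u0 y - \<sigma> * a) *\<^sub>R er"
        by (simp add: nominal_field_def algebra_simps)
      ultimately have "dist (nominal_field u0 y) (Jr *v z + (\<sigma> * a) *\<^sub>R er) < e"
        using e'(2) norm_triangle_ineq[of "Jr *v y - Jr *v z" "(u0 y - \<sigma> * a) *\<^sub>R (er::real^'n::_)"]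
        unfolding dist_norm eq by linarith
      then show "\<exists>y\<in>?U. dist y (Jr *v z + (\<sigma> * a) *\<^sub>R er) < e" using y(1) by auto
    qed
    then show "Jr *v z + (\<sigma> * a) *\<^sub>R er \<in> closure (convex hull ?U)"
      using closure_mono[OF hull_subset] by blast
  qed
  then have "V' z (Jr *v z + (\<sigma> * a) *\<^sub>R er) \<le> - R"
    by (intro nominal) (auto simp: orbital_derivatives_def dV(2)[OF \<open>z \<noteq> 0\<close>])
  moreover have "V' z (Jr *v z + (\<sigma> * a) *\<^sub>R er) = V' z (Jr *v z) + \<sigma> * D * a"
    by (simp add: D_def blinfun.add_right blinfun.scaleR_right)
  moreover have "\<sigma> * D = - \<bar>D\<bar>"
    unfolding \<sigma>_def by (auto simp: sgn_if)
  ultimately have nom: "V' z (Jr *v z) - \<bar>D\<bar> * a \<le> - R" by (simp add: mult.commute)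
  have "V' z v \<le> - R + e0" if "e0 > 0" for e0
  proof -
    \<comment> \<open>the three approximations by \<open>e\<close> below (of \<open>dV(z) (J y)\<close>, \<open>a\<close> and \<open>\<Gamma> z\<close>) add up to \<open>C * e\<close>\<close>
    define C where "C = 1 + \<bar>D\<bar> * (1 + k * \<gamma>m)"
    define e where "e = e0 / C"
    have "C > 0" using \<open>k > 0\<close> pert(2) unfolding C_def by (simp add: add_pos_nonneg)
    then have e: "e > 0" "e * C = e0" using that by (auto simp: e_def)
    obtain d1 where d1: "d1 > 0" "negligible {y \<in> ball z d1. \<sigma> * u0 y < a - e}"
      using a(1)[OF e(1)] by blast
    have "isCont (\<lambda>y. V' z (Jr *v y)) z"
      by (intro continuous_intros contJ)
    then obtain d2 where d2: "d2 > 0" "\<And>y. dist y z < d2 \<Longrightarrow> \<bar>V' z (Jr *v y) - V' z (Jr *v z)\<bar> < e"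
      using e(1) unfolding continuous_at_eps_delta dist_real_def by metis
    obtain d3 where d3: "d3 > 0" "\<And>y. dist y z < d3 \<Longrightarrow> \<bar>\<Gamma> y - \<Gamma> z\<bar> < min e (\<Gamma> z)"
      using gain(1,2) e(1) unfolding continuous_at_eps_delta dist_real_def
      by (metis min_less_iff_conj)
    have "\<exists>d>0. \<forall>y. dist y z < d \<longrightarrow> y \<noteq> 0 \<and> (D \<noteq> 0 \<longrightarrow> \<bar>V' y er - D\<bar> < \<bar>D\<bar>)"
    proof -
      have "isCont (\<lambda>y. V' y er) z" using contV' by (intro continuous_intros)
      then have "\<exists>d>0. \<forall>y. dist y z < d \<longrightarrow> (D \<noteq> 0 \<longrightarrow> \<bar>V' y er - D\<bar> < \<bar>D\<bar>)"
        unfolding continuous_at_eps_delta dist_real_def D_def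
        by (cases "blinfun_apply (V' z) er = 0") (auto intro: exI[of _ 1])
      then obtain d where "d > 0" "\<And>y. dist y z < d \<Longrightarrow> D \<noteq> 0 \<Longrightarrow> \<bar>V' y er - D\<bar> < \<bar>D\<bar>" by blast
      then show ?thesis using \<open>z \<noteq> 0\<close>
        by (intro exI[of _ "min d (dist 0 z)"]) auto
    qed
    then obtain d4 where d4: "d4 > 0" "\<And>y. dist y z < d4 \<Longrightarrow> y \<noteq> 0"
      "\<And>y. dist y z < d4 \<Longrightarrow> D \<noteq> 0 \<Longrightarrow> \<bar>V' y er - D\<bar> < \<bar>D\<bar>" by blast
    define d where "d = min (min d1 d2) (min d3 d4)"
    define b where "b = V' z (Jr *v z) + e - \<bar>D\<bar> * (- \<phi>b + h + (a - e) + k * \<gamma>m * (\<Gamma> z - e))"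
    have "V' z v \<le> b"
    proof (rule filippov_linear_le[OF _ _ d1(2) _ v])
      show "linear (blinfun_apply (V' z))" by (simp add: blinfun.bounded_linear_right bounded_linear.linear)
      show "d > 0" using d1 d2 d3 d4 by (simp add: d_def)
      fix y w
      assume y: "y \<in> ball z d - {y \<in> ball z d1. \<sigma> * u0 y < a - e}"
        and w: "w \<in> (\<lambda>u. Jr *v y + (\<phi>t + \<gamma>t * u) *\<^sub>R er) `
              {g \<bar>u0 y\<bar> * u0 y + k * s * \<Gamma> y | s. s \<in> msgn (u0 y)}"
      have yd: "dist y z < d1" "dist y z < d2" "dist y z < d3" "dist y z < d4"
        using y by (auto simp: d_def dist_commute)
      have ua: "\<sigma> * u0 y \<ge> a - e" using y yd(1) by (auto simp: dist_commute)
      obtain s where s: "s \<in> msgn (u0 y)"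
        "w = Jr *v y + (\<phi>t + \<gamma>t * (g \<bar>u0 y\<bar> * u0 y + k * s * \<Gamma> y)) *\<^sub>R er" using w by blast
      define u where "u = g \<bar>u0 y\<bar> * u0 y + k * s * \<Gamma> y"
      have \<Gamma>y: "\<Gamma> y > 0" "\<Gamma> y \<ge> \<Gamma> z - e" using d3(2)[OF yd(3)] by auto
      have push: "(\<phi>t + \<gamma>t * u) * D \<le> - \<bar>D\<bar> * (- \<phi>b + h + (a - e) + k * \<gamma>m * (\<Gamma> z - e))"
      proof (cases "D = 0")
        case False
        have Dy: "dV_last V y * D > 0"
          using d4(3)[OF yd(4) False] unfolding dV(1)[OF d4(2)[OF yd(4)]]
          by (auto simp: zero_less_mult_iff abs_if split: if_splits)
        have "u0 y \<noteq> 0" using sign(2)[OF d4(2)[OF yd(4)]] Dy by auto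
        have "\<bar>u0 y\<bar> = \<sigma> * u0 y"
          using sign(1)[OF d4(2)[OF yd(4)]] Dy \<open>u0 y \<noteq> 0\<close> False
          by (auto simp: \<sigma>_def sgn_if mult_le_0_iff zero_less_mult_iff)
        then have s\<sigma>: "\<sigma> * s = 1"
          using s(1) \<open>u0 y \<noteq> 0\<close> \<sigma>(1) unfolding msgn_def by auto
        have su: "\<sigma> * u = g \<bar>u0 y\<bar> * \<bar>u0 y\<bar> + k * \<Gamma> y"
        proof -
          have "\<sigma> * u = g \<bar>u0 y\<bar> * (\<sigma> * u0 y) + k * (\<sigma> * s) * \<Gamma> y"
            by (simp add: u_def algebra_simps)
          then show ?thesis using s\<sigma> \<open>\<bar>u0 y\<bar> = \<sigma> * u0 y\<close> by simp
        qed
        have "g \<bar>u0 y\<bar> * \<bar>u0 y\<bar> + k * \<Gamma> y \<ge> 0"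
          using g[of "\<bar>u0 y\<bar>"] \<Gamma>y(1) \<open>k > 0\<close> by simp
        then have "\<gamma>t * (\<sigma> * u) \<ge> \<gamma>m * (g \<bar>u0 y\<bar> * \<bar>u0 y\<bar> + k * \<Gamma> y)"
          unfolding su using pert(3) by (rule mult_right_mono[rotated])
        moreover have "\<gamma>m * (g \<bar>u0 y\<bar> * \<bar>u0 y\<bar>) \<ge> h + \<bar>u0 y\<bar>"
          using h[of "\<bar>u0 y\<bar>"] by (simp add: algebra_simps)
        moreover have "k * \<gamma>m * \<Gamma> y \<ge> k * \<gamma>m * (\<Gamma> z - e)"
          using \<Gamma>y(2) \<open>k > 0\<close> pert(2) by (intro mult_left_mono) auto
        moreover have "\<sigma> * \<phi>t \<ge> - \<phi>b"
          using pert(1) \<sigma>(1) abs_mult[of \<sigma> \<phi>t] by auto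
        ultimately have "- \<phi>b + h + (a - e) + k * \<gamma>m * (\<Gamma> z - e) \<le> \<sigma> * (\<phi>t + \<gamma>t * u)"
          using ua \<open>\<bar>u0 y\<bar> = \<sigma> * u0 y\<close> by (simp add: algebra_simps)
        then have "\<bar>D\<bar> * (- \<phi>b + h + (a - e) + k * \<gamma>m * (\<Gamma> z - e)) \<le> \<bar>D\<bar> * (\<sigma> * (\<phi>t + \<gamma>t * u))"
          by (intro mult_left_mono) auto
        also have "\<dots> = - ((\<phi>t + \<gamma>t * u) * D)" by (subst (2) \<sigma>(3)) (simp add: algebra_simps)
        finally show ?thesis by simp
      qed simp
      have "V' z w = V' z (Jr *v y) + (\<phi>t + \<gamma>t * u) * D"
        unfolding s(2) u_def[symmetric] by (simp add: D_def blinfun.add_right blinfun.scaleR_right)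
      then show "V' z w \<le> b"
        using push d2(2)[OF yd(2)] unfolding b_def by linarith
    qed
    also have "b = V' z (Jr *v z) - \<bar>D\<bar> * a + e * C - \<bar>D\<bar> * (k * \<gamma>m * \<Gamma> z - (\<phi>b - h))"
      by (simp add: b_def C_def algebra_simps)
    also have "\<dots> \<le> - R + e0"
    proof -
      have "0 \<le> \<bar>D\<bar> * (k * \<gamma>m * \<Gamma> z - (\<phi>b - h))" using gain(3) by simp
      then show ?thesis using nom e(2) by linarith
    qed
    finally show ?thesis .
  qed
  then show ?thesis by (rule field_le_epsilon)
qed

section \<open>The asymptotic bound\<close>

text \<open>
  Both \<open>u\<close> and \<open>- u\<close> are linear in the control value, so the pointwise estimate of the feedback at
  almost all nearby states survives the regularisation.
\<close>

lemma regularised_feedback_bound: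
  assumes u: "u \<in> filippov (feedback u0 V g k \<eta> z t) x" and "d > 0" and N: "negligible N"
    and u0: "\<And>y. y \<in> ball x d - N \<Longrightarrow> \<bar>u0 y\<bar> \<le> e"
    and gain: "\<And>y. y \<in> ball x d \<Longrightarrow> 0 \<le> gain \<eta> V z t y \<and> gain \<eta> V z t y \<le> B"
    and g: "\<And>x. x \<ge> 0 \<Longrightarrow> g x > 0" "mono_on {0..} g" and "k > 0" and "e \<ge> 0"
  shows "\<bar>u\<bar> \<le> g e * e + k * B"
proof -
  have bound: "\<bar>w\<bar> \<le> g e * e + k * B" if y: "y \<in> ball x d - N" and w: "w \<in> feedback u0 V g k \<eta> z t y" for y w
  proof -
    obtain s where s: "s \<in> msgn (u0 y)" "w = g \<bar>u0 y\<bar> * u0 y + k * s * gain \<eta> V z t y"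
      using w unfolding feedback_def by blast
    have "\<bar>s\<bar> \<le> 1" using s(1) by (cases "u0 y = 0") (auto simp: msgn_def)
    have "g \<bar>u0 y\<bar> * \<bar>u0 y\<bar> \<le> g e * e"
      using u0[OF y] g(1)[of "\<bar>u0 y\<bar>"] g(1)[of e] \<open>e \<ge> 0\<close>
      by (intro mult_mono monotone_onD[OF g(2)]) auto
    moreover have "k * (\<bar>s\<bar> * gain \<eta> V z t y) \<le> k * (1 * B)"
      using gain[of y] y \<open>\<bar>s\<bar> \<le> 1\<close> \<open>k > 0\<close> by (intro mult_left_mono mult_mono) auto
    moreover have "\<bar>w\<bar> \<le> g \<bar>u0 y\<bar> * \<bar>u0 y\<bar> + k * (\<bar>s\<bar> * gain \<eta> V z t y)"
      using abs_triangle_ineq[of "g \<bar>u0 y\<bar> * u0 y" "k * s * gain \<eta> V z t y"]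
        g(1)[of "\<bar>u0 y\<bar>"] gain[of y] y \<open>k > 0\<close>
      unfolding s(2) by (simp add: abs_mult mult.assoc)
    ultimately show ?thesis by simp
  qed
  have "u \<le> g e * e + k * B"
    by (rule filippov_linear_le[OF linear_id[unfolded id_def] \<open>d > 0\<close> N _ u])
       (use bound in \<open>force simp: abs_le_iff\<close>)
  moreover have "- u \<le> g e * e + k * B"
    by (rule filippov_linear_le[OF linear_uminus \<open>d > 0\<close> N _ u])
       (use bound in \<open>force simp: abs_le_iff\<close>)
  ultimately show ?thesis by linarith
qed

theorem lemma1:
  fixes p \<kappa> c \<alpha> k \<epsilon> M \<phi>b \<gamma>m \<gamma>M :: real
    and u0 V :: "real^'n::{finite,linorder} \<Rightarrow> real"
    and g \<eta> \<phi> \<gamma> u :: "real \<Rightarrow> real"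
    and z :: "real \<Rightarrow> real^'n::_"
  assumes "\<kappa> < 0" and "p > 0"
    and "0 \<le> p + (real CARD('n) + 1) * \<kappa>" and "p + (real CARD('n) + 1) * \<kappa> < 1"
    \<comment> \<open>perturbations\<close>
    and "\<phi> \<in> borel_measurable (lebesgue_on {0..})" and "\<gamma> \<in> borel_measurable (lebesgue_on {0..})"
    and "\<phi>b > 0" and "\<gamma>m > 0" and "\<gamma>M > 0"
    and "AE t in lebesgue_on {0..}. \<bar>\<phi> t\<bar> \<le> \<phi>b"
    and "AE t in lebesgue_on {0..}. \<gamma>m \<le> \<gamma> t \<and> \<gamma> t \<le> \<gamma>M"
    \<comment> \<open>nominal feedback and Lyapunov function\<close>
    and "u0 \<in> borel_measurable lebesgue" and "locally_ess_bounded u0"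
    and "\<exists>q. homogeneous_fun p \<kappa> q u0"
    and "finite_time_GAS (nominal_field u0)"
    and "homogeneous_field p \<kappa> \<kappa> (nominal_field u0)"
    and "continuous_on UNIV V" and "V 0 = 0" and "\<And>x. x \<noteq> 0 \<Longrightarrow> V x > 0"
    and "C1_on (- {0}) V"
    and "\<exists>d>0. homogeneous_fun p \<kappa> d V"
    and "c > 0" and "0 < \<alpha>" and "\<alpha> < 1"
    and "\<And>x d. x \<noteq> 0 \<Longrightarrow> d \<in> orbital_derivatives (nominal_field u0) V x \<Longrightarrow> d \<le> - c * V x powr \<alpha>"
    and "\<And>x. x \<noteq> 0 \<Longrightarrow> u0 x * dV_last V x \<le> 0"
    and "\<And>x. x \<noteq> 0 \<Longrightarrow> u0 x = 0 \<Longrightarrow> dV_last V x = 0"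
    \<comment> \<open>controller data\<close>
    and "\<And>x. x \<ge> 0 \<Longrightarrow> g x > 0" and "mono_on {0..} g" and "C1_on {0..} g"
    and "filterlim g at_top at_top"
    and "k > 0"
    and "\<And>t. t \<ge> 0 \<Longrightarrow> \<eta> t > 0" and "antimono_on {0..} \<eta>" and "C1_on {0..} \<eta>"
    and "\<eta> 0 = \<epsilon>" and "\<epsilon> > 0" and "M \<ge> 0"
    and "\<And>t. t \<ge> 0 \<Longrightarrow> - vector_derivative \<eta> (at t within {0..}) \<le> M * \<eta> t"
    and "(\<eta> \<longlongrightarrow> 0) at_top"
    and "M * \<epsilon> powr (1 - \<alpha>) < c"
    \<comment> \<open>a trajectory of the closed-loop system, with a control signal along it\<close>
    and "closed_loop_trajectory u0 V g k \<eta> \<phi> \<gamma> z"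
    and "control_along u0 V g k \<eta> z u"
  shows "Limsup at_top (\<lambda>t. ereal \<bar>u t\<bar>)
           \<le> ereal (M_u0 p \<kappa> g u0 + k * max 1 (Phi_bar k \<gamma>m g \<phi>b))"
proof -
  note kappa = assms(1) and weight_nonneg = assms(3)
    and \<gamma>m = assms(8) and pert_AE = assms(10,11)
    and u0_bdd = assms(13) and field_hom = assms(16)
    and V_cont = assms(17) and V_pos = assms(19) and V_C1 = assms(20) and V_hom = assms(21)
    and c = assms(22) and \<alpha> = assms(23,24) and nominal = assms(25) and sign = assms(26,27)
    and g = assms(28,29) and g_lim = assms(31) and k = assms(32)
    and \<eta>_pos = assms(33) and \<eta>_mono = assms(34) and \<eta>_C1 = assms(35) and \<eta>_0 = assms(36)
    and \<epsilon> = assms(37) and \<eta>_rate = assms(39) and \<eta>_lim = assms(40) and M_c = assms(41)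
    and traj = assms(42) and control = assms(43)
  define q where "q = p + real CARD('n) * \<kappa>"
  have "q > 0" using kappa weight_nonneg by (simp add: q_def algebra_simps)
  have u0_hom: "homogeneous_fun p \<kappa> q u0"
    unfolding q_def by (rule nominal_field_homogeneous_imp[OF field_hom])
  have M0: "M_u0 p \<kappa> g u0 = 0" using M_u0_eq_0[OF u0_hom] \<open>q > 0\<close> by simp
  have weights: "p + (real (pos i) - 1) * \<kappa> > 0" for i :: 'n
  proof -
    have "(real CARD('n) + 1) * \<kappa> < (real (pos i) - 1) * \<kappa>"
      using pos_bounds(2)[of i] kappa by (intro mult_strict_right_mono_neg) auto
    then show ?thesis using weight_nonneg by linarith
  qed
  obtain V' where V': "\<And>x. x \<noteq> 0 \<Longrightarrow> (V has_derivative blinfun_apply (V' x)) (at x)"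
    "continuous_on (- {0}) V'"
  proof -
    obtain V' where V': "\<forall>x\<in>- {0}. (V has_derivative blinfun_apply (V' x)) (at x within - {0})"
      "continuous_on (- {0}) V'"
      using V_C1 unfolding C1_on_def by blast
    moreover have "at x within - {0} = at x" if "x \<noteq> 0" for x :: "real^'n::_"
      using that by (intro at_within_open) auto
    ultimately show thesis using that[of V'] by simp
  qed
  define \<Phi> where "\<Phi> = Phi_bar k \<gamma>m g \<phi>b"
  have \<Phi>: "k * \<gamma>m * \<Phi> = \<phi>b - hm \<gamma>m g"
    using k \<gamma>m by (simp add: \<Phi>_def Phi_bar_def)
  define \<Gamma> where "\<Gamma> = gain \<eta> V z"
  have \<eta>_le: "\<eta> b \<le> \<eta> a" if "0 \<le> a" "a \<le> b" for a b
    using \<eta>_mono that by (auto simp: monotone_on_def)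
  obtain v where v: "\<And>t. t \<ge> 0 \<Longrightarrow> v absolutely_integrable_on {0..t}"
    "\<And>t. t \<ge> 0 \<Longrightarrow> z t = z 0 + integral {0..t} v"
    and v_AE: "AE t in lebesgue_on {0..}. v t \<in>
      filippov (\<lambda>y. (\<lambda>u. Jr *v y + (\<phi> t + \<gamma> t * u) *\<^sub>R er) ` feedback u0 V g k \<eta> z t y) (z t)"
    using traj unfolding closed_loop_trajectory_def filippov_solution_def by auto
  have "AE t in lebesgue_on {0..}. v t \<in>
      filippov (\<lambda>y. (\<lambda>u. Jr *v y + (\<phi> t + \<gamma> t * u) *\<^sub>R er) ` feedback u0 V g k \<eta> z t y) (z t) \<and>
      \<bar>\<phi> t\<bar> \<le> \<phi>b \<and> \<gamma>m \<le> \<gamma> t"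
    using v_AE pert_AE by eventually_elim auto
  then obtain N where N: "negligible N" and vN: "\<And>t. t \<ge> 0 \<Longrightarrow> t \<notin> N \<Longrightarrow> v t \<in>
      filippov (\<lambda>y. (\<lambda>u. Jr *v y + (\<phi> t + \<gamma> t * u) *\<^sub>R er) ` feedback u0 V g k \<eta> z t y) (z t) \<and>
      \<bar>\<phi> t\<bar> \<le> \<phi>b \<and> \<gamma>m \<le> \<gamma> t"
    by (subst (asm) AE_restrict_space_iff) (auto simp: eventually_ae_filter_negligible)
  have v_on: "v absolutely_integrable_on {a..b}" if "0 \<le> a" "a \<le> b" for a b
    by (rule set_integrable_subset[OF v(1)[of b]]) (use that in auto)
  have z_on: "z t = z a + integral {a..t} v" if "0 \<le> a" "t \<in> {a..b}" for a b t
  proof -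
    have "v integrable_on {0..t}" using v(1)[of t] that set_lebesgue_integral_eq_integral(1) by auto
    then have "integral {0..a} v + integral {a..t} v = integral {0..t} v"
      using that by (intro Henstock_Kurzweil_Integration.integral_combine) auto
    then show ?thesis using v(2)[of a] v(2)[of t] that by (simp add: algebra_simps)
  qed
  have z_cont: "continuous_on {0..b} z" if "b \<ge> 0" for b
  proof (rule continuous_on_eq[where f = "\<lambda>t. z 0 + integral {0..t} v"])
    show "continuous_on {0..b} (\<lambda>t. z 0 + integral {0..t} v)"
      using v(1)[OF that] set_lebesgue_integral_eq_integral(1)
      by (intro continuous_intros indefinite_integral_continuous_1) auto
  qed (simp add: v(2)[symmetric])
  have z_cont: "continuous_on {0..} z"
    unfolding continuous_on_eq_continuous_within
  proof
    fix t :: real assume t: "t \<in> {0..}"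
    have "continuous (at t within {0..t + 1}) z"
      using z_cont[of "t + 1"] t by (simp add: continuous_on_eq_continuous_within)
    moreover have "at t within {0..t + 1} = at t within {0..}"
      by (rule at_within_nhd[of _ "{..<t + 1}"]) auto
    ultimately show "continuous (at t within {0..}) z" by simp
  qed
  have Vz_cont: "continuous_on {0..} (\<lambda>t. V (z t))"
    by (rule continuous_on_compose2[OF V_cont z_cont]) auto
  have \<eta>_cont: "continuous_on {0..} \<eta>"
  proof -
    obtain \<eta>' where "\<And>t. t \<ge> 0 \<Longrightarrow> (\<eta> has_derivative blinfun_apply (\<eta>' t)) (at t within {0..})"
      using \<eta>_C1 unfolding C1_on_def by auto
    then show ?thesis
      by (intro has_derivative_continuous_on[where f' = "\<lambda>t. blinfun_apply (\<eta>' t)"]) auto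
  qed
  have rate: "V' (z t) (v t) \<le> - (c * V (z t) powr \<alpha>)"
    if "t \<ge> 0" "t \<notin> N" "z t \<noteq> 0" "isCont (\<Gamma> t) (z t)" "\<Gamma> t (z t) > 0" "\<Gamma> t (z t) \<ge> \<Phi>" for t
  proof (rule velocity_decreases[OF that(3) V' u0_bdd _ sign _ \<gamma>m _ k g(1) _ that(4,5)])
    show "\<bar>\<phi> t\<bar> \<le> \<phi>b" "\<gamma>m \<le> \<gamma> t" using vN[OF that(1,2)] by auto
    show "\<phi>b - hm \<gamma>m g \<le> k * \<gamma>m * \<Gamma> t (z t)"
      unfolding \<Phi>[symmetric] using that(6) k \<gamma>m by (intro mult_left_mono) auto
    show "v t \<in> filippov (\<lambda>y. (\<lambda>u. Jr *v y + (\<phi> t + \<gamma> t * u) *\<^sub>R er) `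
        {g \<bar>u0 y\<bar> * u0 y + k * s * \<Gamma> t y | s. s \<in> msgn (u0 y)}) (z t)"
      using vN[OF that(1,2)] unfolding feedback_def \<Gamma>_def by simp
    show "hm \<gamma>m g \<le> x * (\<gamma>m * g x - 1)" if "x \<ge> 0" for x
      by (rule hm_le[OF \<gamma>m g(1) g_lim that])
    show "d \<le> - (c * V (z t) powr \<alpha>)"
      if "d \<in> orbital_derivatives (nominal_field u0) V (z t)" for d
      using nominal[OF \<open>z t \<noteq> 0\<close> that] by simp
  qed auto
  \<comment> \<open>the switching time is finite: otherwise the gain is \<open>t\<close> forever, \<open>V\<close> stays positive by
    continuity, and \<open>V\<^bsup>1-\<alpha>\<^esup>\<close> decreases linearly from time \<open>max 1 \<Phi>\<close> on\<close>
  obtain T where T: "T \<ge> 0" "\<And>t. t \<ge> T \<Longrightarrow> switch_time \<eta> V z \<le> ereal t"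
  proof (cases "V (z 0) \<le> \<eta> 0 / 2")
    case True
    then show thesis by (intro that[of 0]) (auto simp: switch_time_def)
  next
    case False
    have "\<exists>t>0. V (z t) = \<eta> t / 2"
    proof (rule ccontr)
      assume none: "\<not> ?thesis"
      then have empty: "{t. 0 < t \<and> V (z t) = \<eta> t / 2} = {}" by blast
      have "switch_time \<eta> V z = \<infinity>"
        using False by (simp only: switch_time_def empty image_empty Inf_empty top_ereal_def if_False)
      then have gain: "\<Gamma> t = (\<lambda>y. t)" for t
        unfolding \<Gamma>_def gain_def by simp
      have above: "V (z t) > \<eta> t / 2" if "t \<ge> 0" for t
      proof (rule ccontr)
        assume "\<not> ?thesis"
        then have "\<exists>s\<ge>0. s \<le> t \<and> V (z s) - \<eta> s / 2 = 0"
          using False that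
          by (intro IVT2' continuous_intros continuous_on_subset[OF Vz_cont] continuous_on_subset[OF \<eta>_cont]) auto
        then obtain s where "s \<ge> 0" "V (z s) = \<eta> s / 2" by auto
        then show False using none False by (cases "s = 0") auto
      qed
      have nz: "z t \<noteq> 0" if "t \<ge> 0" for t
        using above[OF that] \<eta>_pos[OF that] assms(18) by auto
      define a where "a = max 1 \<Phi>"
      \<comment> \<open>the time by which linear decrease would bring \<open>V\<^bsup>1-\<alpha>\<^esup>\<close> down to \<open>-1\<close>\<close>
      define b where "b = a + (V (z a) powr (1 - \<alpha>) + 1) / ((1 - \<alpha>) * c)"
      have ac: "(1 - \<alpha>) * c > 0" using \<alpha> c by simp
      have ab: "0 \<le> a" "a \<le> b" using ac by (auto simp: a_def b_def)
      have "V (z b) powr (1 - \<alpha>) \<le> V (z a) powr (1 - \<alpha>) - (1 - \<alpha>) * c * (b - a)"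
      proof (rule Lyapunov_powr_decrease[OF ab(2) v_on[OF ab] z_on[OF ab(1)] _ V_pos V' N \<alpha>(2)])
        fix t assume t: "t \<in> {a..b} - N"
        have "t > 0" "t \<ge> \<Phi>" using t by (auto simp: a_def)
        then show "V' (z t) (v t) \<le> - (c * V (z t) powr \<alpha>)"
          using t nz[of t] by (intro rate) (auto simp: gain)
      qed (use nz ab in auto)
      also have "(1 - \<alpha>) * c * (b - a) = V (z a) powr (1 - \<alpha>) + 1"
        using c \<alpha> by (simp add: b_def)
      finally show False using powr_ge_zero[of "V (z b)" "1 - \<alpha>"] by linarith
    qed
    then obtain s where s: "s > 0" "V (z s) = \<eta> s / 2" by blast
    have "switch_time \<eta> V z \<le> ereal s"
      using False s unfolding switch_time_def by (auto intro: Inf_lower)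
    then show thesis
      using s by (intro that[of s]) (auto elim: order_trans)
  qed
  have barrier: "\<Gamma> t = (\<lambda>y. barrier (\<eta> t) (V y))" and V_less: "V (z t) < \<eta> t" if "t \<ge> T" for t
    using T(2)[OF that] T(1) that traj
    unfolding \<Gamma>_def gain_def closed_loop_trajectory_def by (simp_all add: not_less[symmetric])
  have V_isCont: "isCont V y" for y
    using V_cont by (simp add: continuous_on_eq_continuous_at)
  have gain_isCont: "isCont (\<Gamma> t) (z t)" if "t \<ge> T" for t
    unfolding barrier[OF that] barrier_def
    using V_less[OF that] by (intro continuous_intros V_isCont) auto
  define G where "G = max 1 \<Phi>"
  have gain_le: "\<exists>t1\<ge>T. \<forall>t\<ge>t1. \<Gamma> t (z t) \<le> G'" if "G' > G" for G'
  proof -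
    \<comment> \<open>the ratio \<open>V / \<eta>\<close> at which the barrier gain equals \<open>G'\<close>; it is positive, so \<open>z \<noteq> 0\<close> above it\<close>
    define \<rho> where "\<rho> = 1 - 1 / G'"
    have "G' > 1" "G' > \<Phi>" using that by (auto simp: G_def)
    then have \<rho>: "\<rho> > 0" "1 - \<rho> = 1 / G'" by (auto simp: \<rho>_def)
    have gain_iff: "\<Gamma> t (z t) \<le> G' \<longleftrightarrow> V (z t) \<le> \<rho> * \<eta> t"
      "\<Gamma> t (z t) \<ge> G' \<longleftrightarrow> V (z t) \<ge> \<rho> * \<eta> t" if "t \<ge> T" for t
      using V_less[OF that] \<open>G' > 1\<close> unfolding barrier[OF that] barrier_def \<rho>_def
      by (auto simp: field_simps)
    define \<delta> where "\<delta> = c * \<epsilon> powr (\<alpha> - 1) - M"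
    have "\<delta> > 0"
    proof -
      have "M * \<epsilon> powr (1 - \<alpha>) * \<epsilon> powr (\<alpha> - 1) < c * \<epsilon> powr (\<alpha> - 1)"
        using M_c \<epsilon> by (intro mult_strict_right_mono) auto
      moreover have "\<epsilon> powr (1 - \<alpha>) * \<epsilon> powr (\<alpha> - 1) = 1"
        using \<epsilon> by (simp add: powr_add[symmetric])
      ultimately show ?thesis by (simp add: \<delta>_def mult.assoc)
    qed
    have "\<exists>t1\<ge>T. \<forall>t\<ge>t1. V (z t) \<le> \<rho> * \<eta> t"
    proof (rule eventually_below_ratio[OF _ _ _ \<rho>(1) \<open>\<delta> > 0\<close>])
      show "continuous_on {T..} (\<lambda>t. V (z t))" "continuous_on {T..} \<eta>"
        using T(1) by (auto intro: continuous_on_subset[OF Vz_cont] continuous_on_subset[OF \<eta>_cont])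
      show "\<eta> t > 0" if "t \<ge> T" for t using \<eta>_pos T(1) that by auto
      fix a b assume ab: "T \<le> a" "a \<le> b" and high: "\<And>t. t \<in> {a..b} \<Longrightarrow> \<rho> * \<eta> t \<le> V (z t)"
      have "0 \<le> a" using ab T(1) by simp
      have nz: "z t \<noteq> 0" if "t \<in> {a..b}" for t
        using high[OF that] mult_pos_pos[OF \<rho>(1) \<eta>_pos[of t]] assms(18) that \<open>0 \<le> a\<close> by auto
      have "ln (V (z b)) \<le> ln (V (z a)) - c * \<epsilon> powr (\<alpha> - 1) * (b - a)"
      proof (rule Lyapunov_ln_decrease[OF ab(2) v_on[OF \<open>0 \<le> a\<close> ab(2)] z_on[OF \<open>0 \<le> a\<close>] _ V_pos V' N \<alpha>(2) c])
        fix t assume t: "t \<in> {a..b} - N"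
        then have "t \<ge> T" "\<Gamma> t (z t) \<ge> G'" using gain_iff(2)[of t] high[of t] ab by auto
        then show "V' (z t) (v t) \<le> - (c * V (z t) powr \<alpha>)"
          using t T(1) \<open>G' > 1\<close> \<open>G' > \<Phi>\<close> by (intro rate nz gain_isCont) auto
      next
        fix t assume t: "t \<in> {a..b}"
        then show "V (z t) \<le> \<epsilon>"
          using V_less[of t] \<eta>_le[of 0 t] \<eta>_0 ab T(1) by auto
      qed (use nz in auto)
      moreover have "ln (\<eta> a) - M * (b - a) \<le> ln (\<eta> b)"
        by (rule ln_decay_rate[OF \<eta>_pos \<eta>_C1 \<eta>_rate \<open>0 \<le> a\<close> ab(2)])
      ultimately show "ln (V (z b)) - ln (\<eta> b) \<le> ln (V (z a)) - ln (\<eta> a) - \<delta> * (b - a)"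
        by (simp add: \<delta>_def left_diff_distrib)
    qed
    then obtain t1 where "t1 \<ge> T" "\<And>t. t \<ge> t1 \<Longrightarrow> V (z t) \<le> \<rho> * \<eta> t" by blast
    then show ?thesis using gain_iff(1) by (intro exI[of _ t1]) auto
  qed
  have eventually_le: "eventually (\<lambda>t. \<bar>u t\<bar> \<le> k * G + e) at_top" if "e > 0" for e
  proof -
    \<comment> \<open>the final estimate is \<open>g 1 * e' + k * (G + 2 * e')\<close>: one \<open>e'\<close> in the gain for the asymptotic
      bound, one for the variation of the gain near the state\<close>
    define e' where "e' = min 1 (e / (g 1 + 2 * k))"
    have gk: "g 1 + 2 * k > 0" using g(1)[of 1] k by simp
    have e': "e' > 0" "e' \<le> 1" "e' * (g 1 + 2 * k) \<le> e"
      using gk that by (simp_all add: e'_def flip: pos_le_divide_eq[OF gk])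
    obtain d N0 where d: "d > 0" "negligible N0"
      "\<And>y. norm y < d \<Longrightarrow> y \<notin> N0 \<Longrightarrow> \<bar>u0 y\<bar> \<le> e'"
      using homogeneous_essentially_small[OF u0_hom \<open>q > 0\<close> u0_bdd e'(1)] by blast
    obtain m where m: "m > 0" "\<And>y. V y < m \<Longrightarrow> norm y < d / 2"
      using V_hom homogeneous_small_imp_small[OF _ _ V_cont V_pos weights, of _ "d / 2"] d(1)
      by (metis half_gt_zero)
    obtain t1 where t1: "t1 \<ge> T" "\<And>t. t \<ge> t1 \<Longrightarrow> \<Gamma> t (z t) \<le> G + e'"
      using gain_le[of "G + e'"] e'(1) by auto
    have "eventually (\<lambda>t. \<eta> t < m) at_top"
      using \<eta>_lim m(1) by (rule order_tendstoD(2))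
    then show ?thesis
      using eventually_ge_at_top[of t1]
    proof eventually_elim
      case (elim t)
      have "t \<ge> T" "t \<ge> 0" using elim t1(1) T(1) by auto
      have "norm (z t) < d / 2" using m(2) V_less[OF \<open>t \<ge> T\<close>] elim by simp
      have "\<Gamma> t (z t) > 0"
        using V_less[OF \<open>t \<ge> T\<close>] \<eta>_pos[OF \<open>t \<ge> 0\<close>] by (simp add: barrier[OF \<open>t \<ge> T\<close>] barrier_def)
      then obtain r where r: "r > 0" "\<And>y. dist y (z t) < r \<Longrightarrow> \<bar>\<Gamma> t y - \<Gamma> t (z t)\<bar> < min e' (\<Gamma> t (z t))"
        using gain_isCont[OF \<open>t \<ge> T\<close>] e'(1) unfolding continuous_at_eps_delta dist_real_def
        by (metis min_less_iff_conj)
      have "\<bar>u t\<bar> \<le> g e' * e' + k * (G + 2 * e')"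
      proof (rule regularised_feedback_bound[OF _ _ d(2) _ _ g k])
        show "u t \<in> filippov (feedback u0 V g k \<eta> z t) (z t)"
          using control \<open>t \<ge> 0\<close> unfolding control_along_def by simp
        show "min r (d / 2) > 0" using r(1) d(1) by simp
        show "\<bar>u0 y\<bar> \<le> e'" if "y \<in> ball (z t) (min r (d / 2)) - N0" for y
        proof (rule d(3))
          have "norm (y - z t) < d / 2" using that by (simp add: dist_norm norm_minus_commute)
          then show "norm y < d"
            using \<open>norm (z t) < d / 2\<close> norm_triangle_sub[of y "z t"] by linarith
        qed (use that in auto)
        show "0 \<le> gain \<eta> V z t y \<and> gain \<eta> V z t y \<le> G + 2 * e'"
          if "y \<in> ball (z t) (min r (d / 2))" for y
          using r(2)[of y] t1(2)[of t] elim that unfolding \<Gamma>_def by (auto simp: dist_commute)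
      qed (use e' in auto)
      also have "g e' * e' \<le> g 1 * e'"
        using e' by (intro mult_right_mono monotone_onD[OF g(2)]) auto
      finally show ?case using e'(3) by (simp add: algebra_simps)
    qed
  qed
  have "Limsup at_top (\<lambda>t. ereal \<bar>u t\<bar>) \<le> ereal (k * G) + ereal e" if "e > 0" for e
    using eventually_le[OF that] by (intro Limsup_bounded) (auto elim: eventually_mono)
  then have "Limsup at_top (\<lambda>t. ereal \<bar>u t\<bar>) \<le> ereal (k * G)"
    by (rule ereal_le_epsilon2)
  then show ?thesis by (simp add: M0 G_def \<Phi>_def)
qed

end
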